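(* Let $a,b>0$, $\gamma,\widetilde\gamma\in\mathbb{R}$, $\theta_2\in[-\pi,\pi]$, and put $\tau=\cos\theta_2$. Let $E\in(0,\infty)\setminus\sigma(\mathscr{H}_\gamma^{\theta_2})$ and $k=E^{1/2}$. Then $E\in\sigma_{\rm disc}(\mathscr{H}_{\gamma,\widetilde\gamma}^{\theta_2})$ if and only if $$ f_{\widetilde\gamma}^\tau(k)=\begin{cases} f_\gamma^\tau(k)+\sqrt{(f_\gamma^\tau(k))^2-1}, & \text{provided } f_\gamma^\tau(k)<-1,\\[2pt] f_\gamma^\tau(k)-\sqrt{(f_\gamma^\tau(k))^2-1}, & \text{provided } f_\gamma^\tau(k)>1.\end{cases} $$
   Context: Let $\Gamma_0$ be the infinite comb graph with vertices $x_j=(ja,0)$, $j\in\mathbb{Z}$, edges of length $a$ joining $x_{j-1}$ and $x_j$, and, for each $j$, two edges of length $b/2$ joining $x_j$ to $x_j^+=(ja,b/2)$ and to $x_j^-=(ja,-b/2)$. For $\gamma,\widetilde\gamma\in\mathbb{R}$ and $\theta_2\in[-\pi,\pi]$, $\mathscr{H}_{\gamma,\widetilde\gamma}^{\theta_2}$ is the self-adjoint operator in $L^2(\Gamma_0)$ acting as $-\frac{d^2}{dx^2}$ on each edge (functions in $H^2$ on each edge), with a $\delta$-coupling at each internal vertex $x_j$ (continuity of $\psi$ at $x_j$, and the sum of the derivatives of $\psi$ at $x_j$ taken in the outward directions of the edges emanating from $x_j$ equals $c_j\psi(x_j)$), where $c_0=\widetilde\gamma$ and $c_j=\gamma$ for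 $j\neq0$, and with the quasi-periodic conditions $\psi(x_j^+)=e^{i\theta_2}\psi(x_j^-)$, $\psi'(x_j^+)=e^{i\theta_2}\psi'(x_j^-)$ at the degree-one vertices (derivatives on the vertical edges taken with respect to the upward coordinate). Set $\mathscr{H}_\gamma^{\theta_2}:=\mathscr{H}_{\gamma,\gamma}^{\theta_2}$. Let $\Xi=\{k>0:\ \sin(ka)\sin(kb)=0\}$ and, for $\gamma\in\mathbb{R}$, $\tau\in[-1,1]$, define $f_\gamma^\tau:(0,\infty)\setminus\Xi\to\mathbb{R}$ by $$f_\gamma^\tau(k)=\frac{\gamma\sin ka}{2k}+\frac{\sin k(a+b)}{\sin kb}-\tau\frac{\sin ka}{\sin kb}.$$ For $E=k^2>0$ one has $E\in\sigma(\mathscr{H}_\gamma^{\theta_2})$ iff $|f_\gamma^{\cos\theta_2}(k)|\le1$; in particular $E\in(0,\infty)\setminus\sigma(\mathscr{H}_\gamma^{\theta_2})$ means $|f_\gamma^{\cos\theta_2}(k)|>1$. *)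

theory Defs
  imports "HOL-Analysis.Analysis"
begin

text \<open>Edges of the comb graph: for each j :: int there is the horizontal edge
 (Hor, j) of length a joining x_(j-1) (parameter 0) to x_j (parameter a), the upper
 vertical edge (Up, j) of length b/2 joining x_j (parameter 0) to x_j^+ (parameter b/2),
 and the lower vertical edge (Dn, j) of length b/2 joining x_j^- (parameter 0) to x_j
 (parameter b/2); vertical edges are parametrised by the upward coordinate.
 A function on the graph is psi :: int => etype => real => complex, psi j e restricted
 to [0, elen a b e].\<close>

datatype etype = Hor | Up | Dn

definition elen :: "real \<Rightarrow> real \<Rightarrow> etype \<Rightarrow> real" where
  "elen a b e = (case e of Hor \<Rightarrow> a | Up \<Rightarrow> b / 2 | Dn \<Rightarrow> b / 2)"

definition sqint :: "real \<Rightarrow> (real \<Rightarrow> complex) \<Rightarrow> bool" where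
  "sqint l u \<longleftrightarrow> set_borel_measurable lborel {0..l} u \<and>
     set_integrable lborel {0..l} (\<lambda>t. (cmod (u t))^2)"

text \<open>u belongs to H^2(0,l) and w is (a representative of) its second derivative:
 u is C^1 on [0,l] and u' is the indefinite Lebesgue integral of the L^2 function w.\<close>
definition H2sol :: "real \<Rightarrow> (real \<Rightarrow> complex) \<Rightarrow> (real \<Rightarrow> complex) \<Rightarrow> bool" where
  "H2sol l u w \<longleftrightarrow> sqint l w \<and>
     (\<exists>u'. (\<forall>t\<in>{0..l}. (u has_vector_derivative u' t) (at t within {0..l})) \<and>
           (\<forall>t\<in>{0..l}. u' t = u' 0 + (LINT s:{0..t}|lborel. w s)))"

definition edge_norm2 :: "real \<Rightarrow> (real \<Rightarrow> complex) \<Rightarrow> real" where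
  "edge_norm2 l u = (LINT t:{0..l}|lborel. (cmod (u t))^2)"

definition L2g :: "real \<Rightarrow> real \<Rightarrow> (int \<Rightarrow> etype \<Rightarrow> real \<Rightarrow> complex) \<Rightarrow> bool" where
  "L2g a b psi \<longleftrightarrow> (\<forall>j e. sqint (elen a b e) (psi j e)) \<and>
     (\<lambda>j. edge_norm2 a (psi j Hor) + edge_norm2 (b/2) (psi j Up) + edge_norm2 (b/2) (psi j Dn))
        summable_on (UNIV :: int set)"

definition dv :: "real \<Rightarrow> (real \<Rightarrow> complex) \<Rightarrow> real \<Rightarrow> complex" where
  "dv l u t = vector_derivative u (at t within {0..l})"

definition vertex_conds ::
  "real \<Rightarrow> real \<Rightarrow> (int \<Rightarrow> real) \<Rightarrow> real \<Rightarrow> (int \<Rightarrow> etype \<Rightarrow> real \<Rightarrow> complex) \<Rightarrow> bool" where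
  "vertex_conds a b c theta psi \<longleftrightarrow> (\<forall>j::int.
      psi j Hor a = psi (j+1) Hor 0 \<and> psi (j+1) Hor 0 = psi j Up 0 \<and> psi j Up 0 = psi j Dn (b/2) \<and>
      - dv a (psi j Hor) a + dv a (psi (j+1) Hor) 0 + dv (b/2) (psi j Up) 0 - dv (b/2) (psi j Dn) (b/2)
        = complex_of_real (c j) * psi j Up 0 \<and>
      psi j Up (b/2) = exp (\<i> * complex_of_real theta) * psi j Dn 0 \<and>
      dv (b/2) (psi j Up) (b/2) = exp (\<i> * complex_of_real theta) * dv (b/2) (psi j Dn) 0)"

text \<open>psi is in the operator domain and (H - E) psi = g (i.e. -psi'' = g + E psi on each edge)\<close>
definition solves ::
  "real \<Rightarrow> real \<Rightarrow> (int \<Rightarrow> real) \<Rightarrow> real \<Rightarrow> complex \<Rightarrow> (int \<Rightarrow> etype \<Rightarrow> real \<Rightarrow> complex)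
     \<Rightarrow> (int \<Rightarrow> etype \<Rightarrow> real \<Rightarrow> complex) \<Rightarrow> bool" where
  "solves a b c theta E psi g \<longleftrightarrow> L2g a b psi \<and>
     (\<forall>j e. H2sol (elen a b e) (psi j e) (\<lambda>t. - (g j e t + E * psi j e t))) \<and>
     vertex_conds a b c theta psi"

definition zero_on_edges :: "real \<Rightarrow> real \<Rightarrow> (int \<Rightarrow> etype \<Rightarrow> real \<Rightarrow> complex) \<Rightarrow> bool" where
  "zero_on_edges a b psi \<longleftrightarrow> (\<forall>j e. \<forall>t\<in>{0..elen a b e}. psi j e t = 0)"

text \<open>spectrum: E is in the resolvent set iff H - E is a bijection from the domain onto
 L^2 (for the closed operator H the inverse is then automatically bounded)\<close>
definition specH :: "real \<Rightarrow> real \<Rightarrow> (int \<Rightarrow> real) \<Rightarrow> real \<Rightarrow> complex set" where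
  "specH a b c theta = {E. \<not> ((\<forall>g. L2g a b g \<longrightarrow> (\<exists>psi. solves a b c theta E psi g)) \<and>
      (\<forall>psi. solves a b c theta E psi (\<lambda>_ _ _. 0) \<longrightarrow> zero_on_edges a b psi))}"

definition eigsp :: "real \<Rightarrow> real \<Rightarrow> (int \<Rightarrow> real) \<Rightarrow> real \<Rightarrow> complex
    \<Rightarrow> (int \<Rightarrow> etype \<Rightarrow> real \<Rightarrow> complex) set" where
  "eigsp a b c theta E = {psi. solves a b c theta E psi (\<lambda>_ _ _. 0)}"

definition disc_specH :: "real \<Rightarrow> real \<Rightarrow> (int \<Rightarrow> real) \<Rightarrow> real \<Rightarrow> complex set" where
  "disc_specH a b c theta = {E \<in> specH a b c theta.
     (\<exists>\<epsilon>>0. \<forall>\<mu>. \<mu> \<noteq> E \<and> cmod (\<mu> - E) < \<epsilon> \<longrightarrow> \<mu> \<notin> specH a b c theta) \<and>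
     (\<exists>psi\<in>eigsp a b c theta E. \<not> zero_on_edges a b psi) \<and>
     (\<exists>F. finite F \<and> F \<subseteq> eigsp a b c theta E \<and>
        (\<forall>psi\<in>eigsp a b c theta E. \<exists>co. \<forall>j e. \<forall>t\<in>{0..elen a b e}.
            psi j e t = (\<Sum>phi\<in>F. co phi * phi j e t)))}"

definition coup :: "real \<Rightarrow> real \<Rightarrow> int \<Rightarrow> real" where
  "coup \<gamma> \<gamma>t j = (if j = 0 then \<gamma>t else \<gamma>)"

definition specHg :: "real \<Rightarrow> real \<Rightarrow> real \<Rightarrow> real \<Rightarrow> real \<Rightarrow> complex set" where
  "specHg a b \<gamma> \<gamma>t theta = specH a b (coup \<gamma> \<gamma>t) theta"

definition disc_specHg :: "real \<Rightarrow> real \<Rightarrow> real \<Rightarrow> real \<Rightarrow> real \<Rightarrow> complex set" where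
  "disc_specHg a b \<gamma> \<gamma>t theta = disc_specH a b (coup \<gamma> \<gamma>t) theta"

definition Xi :: "real \<Rightarrow> real \<Rightarrow> real set" where
  "Xi a b = {k. k > 0 \<and> sin (k * a) * sin (k * b) = 0}"

definition ff :: "real \<Rightarrow> real \<Rightarrow> real \<Rightarrow> real \<Rightarrow> real \<Rightarrow> real" where
  "ff a b \<gamma> \<tau> k = \<gamma> * sin (k * a) / (2 * k) + sin (k * (a + b)) / sin (k * b)
      - \<tau> * sin (k * a) / sin (k * b)"

end

theory Submission
  imports Defs "HOL-Complex_Analysis.Complex_Analysis"
begin

text \<open>On an edge the equation \<open>- u'' = g + \<kappa>\<^sup>2 u\<close> is solved by variation of constants. Eliminating the
  edges turns \<open>(H - \<kappa>\<^sup>2) \<psi> = g\<close> into the recurrence \<open>y (j + 1) + y (j - 1) - 2 F\<^sub>j y j = h j\<close> for the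
  vertex values \<open>y j = \<psi> (x\<^sub>j)\<close>, where \<open>F\<^sub>j\<close> is the discriminant \<open>f\<close> for the coupling at \<open>x\<^sub>j\<close>. Write
  \<open>F\<close> and \<open>Ft\<close> for its values at the couplings \<open>\<gamma>\<close> and \<open>\<gamma>t\<close>, and let \<open>z + 1/z = 2 F\<close>.

  If \<open>|z| < 1\<close>, convolution with a multiple of \<open>z\<^bsup>|j|\<^esup>\<close> inverts the unperturbed recurrence in \<open>\<ell>\<^sup>2\<close>. The
  perturbation is confined to \<open>j = 0\<close>, so the decaying solutions of the perturbed homogeneous
  recurrence are multiples of \<open>z\<^bsup>|j|\<^esup>\<close>, and this is a solution exactly when \<open>Ft = z\<close>; otherwise the
  perturbed recurrence is uniquely solvable too and \<open>\<kappa>\<^sup>2\<close> is in the resolvent set. If \<open>F \<in> [-1, 1]\<close>,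
  then \<open>|z| = 1\<close> and no decaying sequence responds to a point source, so \<open>\<kappa>\<^sup>2\<close> is in the spectrum of the
  unperturbed operator. Hence off that spectrum \<open>F\<close> is outside \<open>[-1, 1]\<close> and there is such a \<open>z\<close>.

  It remains to isolate the eigenvalue. \<open>Ft = z\<close> implies \<open>Ft\<^sup>2 - 2 F Ft + 1 = 0\<close>. The left-hand side is
  holomorphic in \<open>\<kappa>\<close> on the connected set \<open>sin \<kappa>b \<noteq> 0\<close>, and it does not vanish far up the imaginary
  axis, where both discriminants are asymptotic to \<open>2 cosh (a |\<kappa>|)\<close>; so its zeros are isolated.\<close>

subsection \<open>The equation on a single edge\<close>

definition cs :: "complex \<Rightarrow> real \<Rightarrow> complex" where
  "cs \<kappa> t = cos (\<kappa> * of_real t)"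

definition sn :: "complex \<Rightarrow> real \<Rightarrow> complex" where
  "sn \<kappa> t = sin (\<kappa> * of_real t) / \<kappa>"

lemma cs_0 [simp]: "cs \<kappa> 0 = 1" and sn_0 [simp]: "sn \<kappa> 0 = 0"
  by (simp_all add: cs_def sn_def)

lemma cs_has_vector_derivative:
  assumes "\<kappa> \<noteq> 0"
  shows "(cs \<kappa> has_vector_derivative - (\<kappa>\<^sup>2 * sn \<kappa> t)) (at t within S)"
proof -
  have "((\<lambda>z. cos (\<kappa> * z)) has_field_derivative - sin (\<kappa> * of_real t) * \<kappa>) (at (of_real t))"
    by (auto intro!: derivative_eq_intros)
  from has_vector_derivative_real_field[OF this, of S] show ?thesis
    using assms by (simp add: cs_def[abs_def] sn_def power2_eq_square mult.commute)
qed

lemma sn_has_vector_derivative: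
  assumes "\<kappa> \<noteq> 0"
  shows "(sn \<kappa> has_vector_derivative cs \<kappa> t) (at t within S)"
proof -
  have "((\<lambda>z. sin (\<kappa> * z) / \<kappa>) has_field_derivative cos (\<kappa> * of_real t)) (at (of_real t))"
    using assms by (auto intro!: derivative_eq_intros)
  from has_vector_derivative_real_field[OF this, of S] show ?thesis
    by (simp add: cs_def sn_def[abs_def])
qed

lemma continuous_on_cs [continuous_intros]: "continuous_on S (cs \<kappa>)"
  and continuous_on_sn [continuous_intros]: "continuous_on S (sn \<kappa>)"
  unfolding cs_def[abs_def] sn_def[abs_def] divide_inverse by (intro continuous_intros)+

lemma cs_add: "\<kappa> \<noteq> 0 \<Longrightarrow> cs \<kappa> (s + t) = cs \<kappa> s * cs \<kappa> t - \<kappa>\<^sup>2 * sn \<kappa> s * sn \<kappa> t"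
  by (simp add: cs_def sn_def distrib_left cos_add power2_eq_square)

lemma sn_add: "sn \<kappa> (s + t) = sn \<kappa> s * cs \<kappa> t + cs \<kappa> s * sn \<kappa> t"
  by (simp add: cs_def sn_def distrib_left sin_add add_divide_distrib)

lemma cs_sn_square: "\<kappa> \<noteq> 0 \<Longrightarrow> (cs \<kappa> t)\<^sup>2 + \<kappa>\<^sup>2 * (sn \<kappa> t)\<^sup>2 = 1"
  by (simp add: cs_def sn_def power_divide)

definition primitive :: "(real \<Rightarrow> 'a::banach) \<Rightarrow> real \<Rightarrow> 'a" where
  "primitive g t = integral {0..t} g"

lemma primitive_at_0 [simp]: "primitive g 0 = 0"
  by (simp add: primitive_def)

lemma primitive_const_0 [simp]: "primitive (\<lambda>_. 0) t = 0"
  by (simp add: primitive_def)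

lemma primitive_uminus: "primitive (\<lambda>s. - f s) t = - primitive f t"
  by (simp add: primitive_def)

lemma continuous_on_primitive:
  "g integrable_on {0..l} \<Longrightarrow> continuous_on {0..l} (primitive g)"
  unfolding primitive_def[abs_def] by (rule indefinite_integral_continuous_1)

lemma primitive_has_vector_derivative:
  "continuous_on {0..l} g \<Longrightarrow> t \<in> {0..l} \<Longrightarrow>
    (primitive g has_vector_derivative g t) (at t within {0..l})"
  unfolding primitive_def[abs_def] by (rule integral_has_vector_derivative)

lemma primitive_of_derivative:
  assumes "\<And>s. s \<in> {0..l} \<Longrightarrow> (u has_vector_derivative u' s) (at s within {0..l})" "t \<in> {0..l}"
  shows "primitive u' t = u t - u 0"
  unfolding primitive_def
proof (rule integral_unique, rule fundamental_theorem_of_calculus)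
  show "0 \<le> t" using assms by auto
  show "(u has_vector_derivative u' s) (at s within {0..t})" if "s \<in> {0..t}" for s
    by (rule has_vector_derivative_within_subset[OF assms(1)]) (use assms(2) that in auto)
qed

lemma norm_primitive_le:
  assumes "continuous_on {0..l} f" "\<And>s. s \<in> {0..l} \<Longrightarrow> norm (f s) \<le> B" "t \<in> {0..l}"
  shows "norm (primitive f t) \<le> l * B"
proof -
  have "0 \<le> B" using assms(2)[OF assms(3)] norm_ge_zero order_trans by blast
  have "norm (primitive f t) \<le> B * (t - 0)"
    unfolding primitive_def
    by (rule integral_bound) (use assms continuous_on_subset[OF assms(1)] in auto)
  also have "\<dots> \<le> l * B"
    using assms(3) \<open>0 \<le> B\<close> by (simp add: mult.commute mult_left_mono)
  finally show ?thesis .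
qed



lemma cmod_add_square_le: "(cmod (x + y))\<^sup>2 \<le> 2 * ((cmod x)\<^sup>2 + (cmod y)\<^sup>2)"
proof -
  have "(cmod (x + y))\<^sup>2 \<le> (cmod x + cmod y)\<^sup>2"
    by (intro power_mono norm_triangle_ineq) auto
  also have "\<dots> \<le> 2 * ((cmod x)\<^sup>2 + (cmod y)\<^sup>2)"
    using sum_squares_bound[of "cmod x" "cmod y"] by (simp add: power2_sum)
  finally show ?thesis .
qed

lemma sqint_iff:
  "sqint l u \<longleftrightarrow> (\<lambda>t. indicat_real {0..l} t *\<^sub>R u t) \<in> borel_measurable lborel \<and>
     integrable lborel (\<lambda>t. (cmod (indicat_real {0..l} t *\<^sub>R u t))\<^sup>2)"
proof -
  have "indicat_real {0..l} t *\<^sub>R (cmod (u t))\<^sup>2 = (cmod (indicat_real {0..l} t *\<^sub>R u t))\<^sup>2" for t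
    by (simp add: indicator_def)
  then show ?thesis
    by (simp only: sqint_def set_borel_measurable_def set_integrable_def)
qed

lemma sqint_add:
  assumes "sqint l u" "sqint l v"
  shows "sqint l (\<lambda>t. u t + v t)"
proof -
  let ?u = "\<lambda>t. indicat_real {0..l} t *\<^sub>R u t" and ?v = "\<lambda>t. indicat_real {0..l} t *\<^sub>R v t"
  have [measurable]: "?u \<in> borel_measurable lborel" "?v \<in> borel_measurable lborel"
    using assms by (simp_all only: sqint_iff)
  have "integrable lborel (\<lambda>t. 2 * ((cmod (?u t))\<^sup>2 + (cmod (?v t))\<^sup>2))"
    using assms
    by (intro integrable_mult_right Bochner_Integration.integrable_add) (simp_all only: sqint_iff)
  then have "integrable lborel (\<lambda>t. (cmod (?u t + ?v t))\<^sup>2)"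
  proof (rule Bochner_Integration.integrable_bound)
    show "AE t in lborel. norm ((cmod (?u t + ?v t))\<^sup>2)
      \<le> norm (2 * ((cmod (?u t))\<^sup>2 + (cmod (?v t))\<^sup>2))"
      by (intro AE_I2) (simp only: real_norm_def abs_of_nonneg zero_le_power2 add_nonneg_nonneg
          mult_nonneg_nonneg zero_le_numeral cmod_add_square_le)
  qed measurable
  then show ?thesis
    unfolding sqint_iff scaleR_add_right by (intro conjI) measurable
qed

lemma sqint_cmult: "sqint l u \<Longrightarrow> sqint l (\<lambda>t. c * u t)"
  unfolding sqint_iff mult_scaleR_right[symmetric] norm_mult power_mult_distrib
  by (intro conjI borel_measurable_times integrable_mult_right) auto

lemma sqint_continuous:
  assumes "continuous_on {0..l} u"
  shows "sqint l u"
proof -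
  have "set_integrable lborel {0..l} u" "set_integrable lborel {0..l} (\<lambda>t. (cmod (u t))\<^sup>2)"
    by (intro borel_integrable_atLeastAtMost' continuous_intros assms)+
  then show ?thesis by (auto simp: sqint_def set_borel_measurable_def set_integrable_def)
qed

lemma sqint_set_integrable:
  assumes "sqint l g"
  shows "set_integrable lborel {0..l} g"
proof (rule set_integrable_bound)
  show "set_integrable lborel {0..l} (\<lambda>t. 1 + (cmod (g t))\<^sup>2)"
    using assms borel_integrable_atLeastAtMost'[of 0 l "\<lambda>_. 1 :: real"]
    by (intro set_integral_add) (auto simp: sqint_def)
  show "set_borel_measurable lborel {0..l} g" using assms by (simp add: sqint_def)
  have "cmod z \<le> 1 + (cmod z)\<^sup>2" for z
    using sum_squares_bound[of "cmod z" 1] norm_ge_zero[of z]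
    unfolding mult_1_right power_one by linarith
  then show "AE t in lborel. t \<in> {0..l} \<longrightarrow> norm (g t) \<le> norm (1 + (cmod (g t))\<^sup>2)"
    by auto
qed

lemma sqint_integrable_on: "sqint l g \<Longrightarrow> g integrable_on {0..l}"
  using set_borel_integral_eq_integral(1) sqint_set_integrable by blast

lemma set_lebesgue_integral_eq_primitive:
  assumes "sqint l g" "t \<in> {0..l}"
  shows "(LINT s:{0..t}|lborel. g s) = primitive g t"
  unfolding primitive_def
  by (rule set_borel_integral_eq_integral(2), rule set_integrable_subset[OF sqint_set_integrable])
    (use assms in auto)

lemma edge_norm2_nonneg: "0 \<le> edge_norm2 l u"
  unfolding edge_norm2_def set_lebesgue_integral_def by (rule integral_nonneg_AE) auto

lemma edge_norm2_mono:
  assumes "sqint l u" "sqint l v" "\<And>t. t \<in> {0..l} \<Longrightarrow> (cmod (u t))\<^sup>2 \<le> B * (cmod (v t))\<^sup>2"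
  shows "edge_norm2 l u \<le> B * edge_norm2 l v"
proof -
  have "edge_norm2 l u \<le> (LINT t:{0..l}|lborel. B * (cmod (v t))\<^sup>2)"
    unfolding edge_norm2_def
    using assms by (intro set_integral_mono set_integrable_mult_right) (auto simp: sqint_def)
  then show ?thesis by (simp add: edge_norm2_def)
qed

lemma edge_norm2_le_const:
  assumes "0 \<le> l" "continuous_on {0..l} u" "\<And>t. t \<in> {0..l} \<Longrightarrow> (cmod (u t))\<^sup>2 \<le> B"
  shows "edge_norm2 l u \<le> l * B"
proof -
  have "edge_norm2 l u \<le> B * edge_norm2 l (\<lambda>_. 1)"
    by (rule edge_norm2_mono) (use assms in \<open>auto intro: sqint_continuous\<close>)
  also have "edge_norm2 l (\<lambda>_. 1) = l"
    using assms(1) by (simp add: edge_norm2_def set_lebesgue_integral_def)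
  finally show ?thesis by (simp add: mult.commute)
qed

lemma set_integral_square_le:
  fixes f :: "'a \<Rightarrow> real"
  assumes f: "set_integrable M A f" and f2: "set_integrable M A (\<lambda>x. (f x)\<^sup>2)"
    and A: "measure M A > 0"
  shows "(LINT x:A|M. f x)\<^sup>2 \<le> measure M A * (LINT x:A|M. (f x)\<^sup>2)"
proof -
  define I where "I = (LINT x:A|M. f x)"
  define m where "m = I / measure M A"
  have "A \<in> sets M" "emeasure M A \<noteq> \<infinity>"
    using A measure_notin_sets[of A M] by (fastforce simp: measure_def)+
  then have const: "set_integrable M A (\<lambda>_. c)" "(LINT x:A|M. c) = measure M A * c" for c :: real
    by (simp_all add: set_integrable_def set_integral_const less_top)
  have "0 \<le> (LINT x:A|M. (f x - m)\<^sup>2)"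
    unfolding set_lebesgue_integral_def by (rule integral_nonneg_AE) auto
  also have "\<dots> = (LINT x:A|M. (f x)\<^sup>2 - 2 * m * f x + m\<^sup>2)"
    by (simp add: power2_diff algebra_simps)
  also have "\<dots> = (LINT x:A|M. (f x)\<^sup>2) - 2 * m * I + measure M A * m\<^sup>2"
    using f f2 const by (simp add: I_def)
  also have "\<dots> = (LINT x:A|M. (f x)\<^sup>2) - I\<^sup>2 / measure M A"
    using A by (simp add: m_def field_simps power2_eq_square)
  finally show ?thesis using A by (simp add: I_def[symmetric] field_simps)
qed

lemma primitive_square_le:
  assumes g: "sqint l g" and "l > 0" and t: "t \<in> {0..l}"
  shows "(cmod (primitive g t))\<^sup>2 \<le> l * edge_norm2 l g"
proof -
  have abs_int: "set_integrable lborel {0..l} (\<lambda>s. cmod (g s))"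
    by (rule set_integrable_norm[OF sqint_set_integrable[OF g]])
  then have abs_int_on: "(\<lambda>s. cmod (g s)) integrable_on {0..l}"
    by (rule set_borel_integral_eq_integral(1))
  have sub: "{0..t} \<subseteq> {0..l}" using t by auto
  have "cmod (primitive g t) \<le> integral {0..t} (\<lambda>s. cmod (g s))"
    unfolding primitive_def
    by (intro Henstock_Kurzweil_Integration.integral_norm_bound_integral
        integrable_on_subinterval[OF _ sub] sqint_integrable_on g abs_int_on) simp
  also have "\<dots> \<le> integral {0..l} (\<lambda>s. cmod (g s))"
    by (intro integral_subset_le sub integrable_on_subinterval[OF _ sub] abs_int_on) simp
  also have "\<dots> = (LINT s:{0..l}|lborel. cmod (g s))"
    by (rule set_borel_integral_eq_integral(2)[OF abs_int, symmetric])
  finally have "(cmod (primitive g t))\<^sup>2 \<le> (LINT s:{0..l}|lborel. cmod (g s))\<^sup>2"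
    by (intro power_mono) auto
  also have "\<dots> \<le> l * edge_norm2 l g"
    using set_integral_square_le[OF abs_int] g \<open>l > 0\<close> by (simp add: sqint_def edge_norm2_def)
  finally show ?thesis .
qed

text \<open>The equation \<open>- u'' = g + \<kappa>\<^sup>2 u\<close> as a system for \<open>u\<close> and \<open>u' + \<integral>g\<close>, which are both
  of class \<open>C\<^sup>1\<close> even though \<open>u'\<close> is only absolutely continuous.\<close>

definition edge_system ::
  "real \<Rightarrow> complex \<Rightarrow> (real \<Rightarrow> complex) \<Rightarrow> (real \<Rightarrow> complex) \<Rightarrow> (real \<Rightarrow> complex) \<Rightarrow> bool" where
  "edge_system l \<kappa> g u u' \<longleftrightarrow> (\<forall>t\<in>{0..l}.
     (u has_vector_derivative u' t) (at t within {0..l}) \<and>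
     ((\<lambda>s. u' s + primitive g s) has_vector_derivative - (\<kappa>\<^sup>2 * u t)) (at t within {0..l}))"

lemma edge_system_has_vector_derivative:
  assumes "edge_system l \<kappa> g u u'" "t \<in> {0..l}"
  shows "(u has_vector_derivative u' t) (at t within {0..l})"
    and "((\<lambda>s. u' s + primitive g s) has_vector_derivative - (\<kappa>\<^sup>2 * u t)) (at t within {0..l})"
  using assms by (simp_all add: edge_system_def)

lemma edge_system_continuous_on: "edge_system l \<kappa> g u u' \<Longrightarrow> continuous_on {0..l} u"
  by (rule continuous_on_vector_derivative) (rule edge_system_has_vector_derivative(1))

lemma edge_system_dv: "edge_system l \<kappa> g u u' \<Longrightarrow> t \<in> {0..l} \<Longrightarrow> l > 0 \<Longrightarrow> dv l u t = u' t"
  unfolding dv_def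
  by (rule vector_derivative_within_closed_interval)
    (auto dest: edge_system_has_vector_derivative(1))

lemma sqint_edge_rhs:
  assumes "sqint l g" "continuous_on {0..l} u"
  shows "sqint l (\<lambda>t. - (g t + c * u t))"
  using sqint_cmult[of l _ "-1", OF
      sqint_add[OF assms(1) sqint_cmult[OF sqint_continuous[OF assms(2)]]]]
  by simp

lemma primitive_edge_rhs:
  assumes "sqint l g" "continuous_on {0..l} u" "t \<in> {0..l}"
  shows "primitive (\<lambda>s. - (g s + c * u s)) t = - primitive g t - c * primitive u t"
proof -
  have "{0..t} \<subseteq> {0..l}" using assms(3) by auto
  then have "g integrable_on {0..t}" "u integrable_on {0..t}"
    using sqint_integrable_on[OF assms(1)] sqint_integrable_on[OF sqint_continuous[OF assms(2)]]
    by (blast intro: integrable_on_subinterval)+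
  then show ?thesis
    by (simp add: primitive_def Henstock_Kurzweil_Integration.integral_diff
        integrable_neg integrable_on_mult_right)
qed

lemma H2sol_imp_edge_system:
  assumes "l > 0" and g: "sqint l g" and sol: "H2sol l u (\<lambda>t. - (g t + \<kappa>\<^sup>2 * u t))"
  shows "edge_system l \<kappa> g u (dv l u)"
proof -
  obtain u' where u': "\<And>t. t \<in> {0..l} \<Longrightarrow> (u has_vector_derivative u' t) (at t within {0..l})"
    "\<And>t. t \<in> {0..l} \<Longrightarrow> u' t = u' 0 + (LINT s:{0..t}|lborel. - (g s + \<kappa>\<^sup>2 * u s))"
    using sol unfolding H2sol_def by blast
  have dv: "dv l u t = u' t" if "t \<in> {0..l}" for t
    unfolding dv_def
    by (rule vector_derivative_within_closed_interval) (use u'(1) that assms(1) in auto)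
  have cont: "continuous_on {0..l} u" by (rule continuous_on_vector_derivative[OF u'(1)])
  have eq: "dv l u t + primitive g t = u' 0 - \<kappa>\<^sup>2 * primitive u t" if t: "t \<in> {0..l}" for t
    using dv[OF t] u'(2)[OF t] primitive_edge_rhs[OF g cont t]
      set_lebesgue_integral_eq_primitive[OF sqint_edge_rhs[OF g cont] t]
    by simp
  have "((\<lambda>s. dv l u s + primitive g s) has_vector_derivative - (\<kappa>\<^sup>2 * u t)) (at t within {0..l})"
    if t: "t \<in> {0..l}" for t
  proof (rule has_vector_derivative_transform[OF t eq])
    show "((\<lambda>s. u' 0 - \<kappa>\<^sup>2 * primitive u s) has_vector_derivative - (\<kappa>\<^sup>2 * u t)) (at t within {0..l})"
      using has_vector_derivative_diff[OF has_vector_derivative_const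
          has_vector_derivative_mult_right[OF primitive_has_vector_derivative[OF cont t]]]
      by simp
  qed
  with u'(1) dv show ?thesis by (simp add: edge_system_def)
qed

lemma edge_system_imp_H2sol:
  assumes g: "sqint l g" and sys: "edge_system l \<kappa> g u u'"
  shows "H2sol l u (\<lambda>t. - (g t + \<kappa>\<^sup>2 * u t))"
proof -
  note cont = edge_system_continuous_on[OF sys]
  have "u' t = u' 0 + (LINT s:{0..t}|lborel. - (g s + \<kappa>\<^sup>2 * u s))" if t: "t \<in> {0..l}" for t
  proof -
    have "primitive (\<lambda>s. - (\<kappa>\<^sup>2 * u s)) t = u' t + primitive g t - (u' 0 + primitive g 0)"
      by (rule primitive_of_derivative[OF edge_system_has_vector_derivative(2)[OF sys] t])
    then have "u' t = u' 0 - primitive g t - \<kappa>\<^sup>2 * primitive u t"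
      by (simp add: primitive_def algebra_simps)
    then show ?thesis
      using set_lebesgue_integral_eq_primitive[OF sqint_edge_rhs[OF g cont] t]
        primitive_edge_rhs[OF g cont t] by simp
  qed
  with sqint_edge_rhs[OF g cont] edge_system_has_vector_derivative(1)[OF sys] show ?thesis
    unfolding H2sol_def by blast
qed

text \<open>Variation of constants: the system has the solution \<open>A cos \<kappa>t + B sin \<kappa>t / \<kappa>\<close> with
  \<open>A' = - cos \<kappa>t \<integral>g\<close> and \<open>B' = - \<kappa> sin \<kappa>t \<integral>g\<close>.\<close>

definition cs_amplitude :: "complex \<Rightarrow> (real \<Rightarrow> complex) \<Rightarrow> complex \<Rightarrow> real \<Rightarrow> complex" where
  "cs_amplitude \<kappa> g \<alpha> t = \<alpha> - primitive (\<lambda>s. cs \<kappa> s * primitive g s) t"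

definition sn_amplitude :: "complex \<Rightarrow> (real \<Rightarrow> complex) \<Rightarrow> complex \<Rightarrow> real \<Rightarrow> complex" where
  "sn_amplitude \<kappa> g \<beta> t = \<beta> - \<kappa>\<^sup>2 * primitive (\<lambda>s. sn \<kappa> s * primitive g s) t"

definition edge_sol ::
  "complex \<Rightarrow> (real \<Rightarrow> complex) \<Rightarrow> complex \<Rightarrow> complex \<Rightarrow> real \<Rightarrow> complex" where
  "edge_sol \<kappa> g \<alpha> \<beta> t = cs_amplitude \<kappa> g \<alpha> t * cs \<kappa> t + sn_amplitude \<kappa> g \<beta> t * sn \<kappa> t"

definition edge_sol_deriv ::
  "complex \<Rightarrow> (real \<Rightarrow> complex) \<Rightarrow> complex \<Rightarrow> complex \<Rightarrow> real \<Rightarrow> complex" where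
  "edge_sol_deriv \<kappa> g \<alpha> \<beta> t = - (\<kappa>\<^sup>2 * (cs_amplitude \<kappa> g \<alpha> t * sn \<kappa> t))
     + sn_amplitude \<kappa> g \<beta> t * cs \<kappa> t - primitive g t"

lemma edge_sol_at_0 [simp]: "edge_sol \<kappa> g \<alpha> \<beta> 0 = \<alpha>"
  and edge_sol_deriv_at_0 [simp]: "edge_sol_deriv \<kappa> g \<alpha> \<beta> 0 = \<beta>"
  by (simp_all add: edge_sol_def edge_sol_deriv_def cs_amplitude_def sn_amplitude_def)

lemma edge_sol_superposition:
  "edge_sol \<kappa> g \<alpha> \<beta> t = edge_sol \<kappa> g 0 0 t + (\<alpha> * cs \<kappa> t + \<beta> * sn \<kappa> t)"
  "edge_sol_deriv \<kappa> g \<alpha> \<beta> t = edge_sol_deriv \<kappa> g 0 0 t + (\<beta> * cs \<kappa> t - \<kappa>\<^sup>2 * \<alpha> * sn \<kappa> t)"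
  by (simp_all add: edge_sol_def edge_sol_deriv_def cs_amplitude_def sn_amplitude_def algebra_simps)

lemma edge_sol_homogeneous:
  "edge_sol \<kappa> (\<lambda>_. 0) \<alpha> \<beta> t = \<alpha> * cs \<kappa> t + \<beta> * sn \<kappa> t"
  "edge_sol_deriv \<kappa> (\<lambda>_. 0) \<alpha> \<beta> t = \<beta> * cs \<kappa> t - \<kappa>\<^sup>2 * \<alpha> * sn \<kappa> t"
  by (simp_all add: edge_sol_def edge_sol_deriv_def cs_amplitude_def sn_amplitude_def)

lemma amplitude_has_vector_derivative:
  assumes "g integrable_on {0..l}" "t \<in> {0..l}"
  shows "(cs_amplitude \<kappa> g \<alpha> has_vector_derivative - (cs \<kappa> t * primitive g t)) (at t within {0..l})"
    and "(sn_amplitude \<kappa> g \<beta> has_vector_derivative - (\<kappa>\<^sup>2 * (sn \<kappa> t * primitive g t)))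
      (at t within {0..l})"
proof -
  note integral_deriv = primitive_has_vector_derivative[OF
      continuous_on_mult[OF _ continuous_on_primitive[OF assms(1)]] assms(2)]
  show "(cs_amplitude \<kappa> g \<alpha> has_vector_derivative - (cs \<kappa> t * primitive g t)) (at t within {0..l})"
    using has_vector_derivative_diff[OF has_vector_derivative_const
        integral_deriv[OF continuous_on_cs]]
    by (simp add: cs_amplitude_def[abs_def])
  show "(sn_amplitude \<kappa> g \<beta> has_vector_derivative - (\<kappa>\<^sup>2 * (sn \<kappa> t * primitive g t)))
      (at t within {0..l})"
    using has_vector_derivative_diff[OF has_vector_derivative_const
        has_vector_derivative_mult_right[OF integral_deriv[OF continuous_on_sn]]]
    by (simp add: sn_amplitude_def[abs_def])
qed

lemma edge_system_edge_sol:
  assumes "\<kappa> \<noteq> 0" "sqint l g"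
  shows "edge_system l \<kappa> g (edge_sol \<kappa> g \<alpha> \<beta>) (edge_sol_deriv \<kappa> g \<alpha> \<beta>)"
  unfolding edge_system_def
proof (intro ballI conjI)
  fix t assume t: "t \<in> {0..l}"
  let ?G = "primitive g" and ?A = "cs_amplitude \<kappa> g \<alpha>" and ?B = "sn_amplitude \<kappa> g \<beta>"
  note derivs = amplitude_has_vector_derivative[OF sqint_integrable_on[OF assms(2)] t]
    cs_has_vector_derivative[OF assms(1)] sn_has_vector_derivative[OF assms(1)]
  have "edge_sol_deriv \<kappa> g \<alpha> \<beta> t = - (\<kappa>\<^sup>2 * (?A t * sn \<kappa> t)) + ?B t * cs \<kappa> t
      - ((cs \<kappa> t)\<^sup>2 + \<kappa>\<^sup>2 * (sn \<kappa> t)\<^sup>2) * ?G t"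
    by (simp add: edge_sol_deriv_def cs_sn_square[OF assms(1)])
  also have "\<dots> = (?A t * - (\<kappa>\<^sup>2 * sn \<kappa> t) + - (cs \<kappa> t * ?G t) * cs \<kappa> t)
      + (?B t * cs \<kappa> t + - (\<kappa>\<^sup>2 * (sn \<kappa> t * ?G t)) * sn \<kappa> t)"
    by (simp add: algebra_simps power2_eq_square)
  finally show "(edge_sol \<kappa> g \<alpha> \<beta> has_vector_derivative edge_sol_deriv \<kappa> g \<alpha> \<beta> t)
      (at t within {0..l})"
    unfolding edge_sol_def[abs_def]
    by (simp only: has_vector_derivative_add has_vector_derivative_mult derivs)
  have "(\<lambda>s. edge_sol_deriv \<kappa> g \<alpha> \<beta> s + ?G s) = (\<lambda>s. - (\<kappa>\<^sup>2 * (?A s * sn \<kappa> s)) + ?B s * cs \<kappa> s)"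
    by (simp add: edge_sol_deriv_def)
  moreover have "- (\<kappa>\<^sup>2 * edge_sol \<kappa> g \<alpha> \<beta> t)
      = - (\<kappa>\<^sup>2 * (?A t * cs \<kappa> t + - (cs \<kappa> t * ?G t) * sn \<kappa> t))
        + (?B t * - (\<kappa>\<^sup>2 * sn \<kappa> t) + - (\<kappa>\<^sup>2 * (sn \<kappa> t * ?G t)) * cs \<kappa> t)"
    by (simp add: edge_sol_def algebra_simps)
  ultimately show "((\<lambda>s. edge_sol_deriv \<kappa> g \<alpha> \<beta> s + ?G s) has_vector_derivative
      - (\<kappa>\<^sup>2 * edge_sol \<kappa> g \<alpha> \<beta> t)) (at t within {0..l})"
    by (simp only: has_vector_derivative_add has_vector_derivative_minus
        has_vector_derivative_mult_right has_vector_derivative_mult derivs)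
qed

lemmas continuous_on_edge_sol = edge_system_continuous_on[OF edge_system_edge_sol]

lemma harmonic_oscillator_unique:
  fixes \<kappa> :: complex
  assumes "\<kappa> \<noteq> 0"
    and u: "\<And>t. t \<in> {0..l} \<Longrightarrow> (u has_vector_derivative v t) (at t within {0..l})" "u 0 = 0"
    and v: "\<And>t. t \<in> {0..l} \<Longrightarrow> (v has_vector_derivative - (\<kappa>\<^sup>2 * u t)) (at t within {0..l})" "v 0 = 0"
    and t: "t \<in> {0..l}"
  shows "u t = 0" "v t = 0"
proof -
  note derivs = cs_has_vector_derivative[OF assms(1)] sn_has_vector_derivative[OF assms(1)]
  define p q where "p t = u t * cs \<kappa> t - v t * sn \<kappa> t"
    and "q t = \<kappa>\<^sup>2 * (u t * sn \<kappa> t) + v t * cs \<kappa> t" for t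
  have "(p has_vector_derivative 0) (at t within {0..l})" if "t \<in> {0..l}" for t
  proof -
    have "(p has_vector_derivative (u t * - (\<kappa>\<^sup>2 * sn \<kappa> t) + v t * cs \<kappa> t)
        - (v t * cs \<kappa> t + - (\<kappa>\<^sup>2 * u t) * sn \<kappa> t)) (at t within {0..l})"
      unfolding p_def by (intro has_vector_derivative_diff has_vector_derivative_mult u v that derivs)
    then show ?thesis by simp
  qed
  from primitive_of_derivative[OF this t] have p: "p t = 0" by (simp add: p_def u v)
  have "(q has_vector_derivative 0) (at t within {0..l})" if "t \<in> {0..l}" for t
  proof -
    have "(q has_vector_derivative \<kappa>\<^sup>2 * (u t * cs \<kappa> t + v t * sn \<kappa> t)
        + (v t * - (\<kappa>\<^sup>2 * sn \<kappa> t) + - (\<kappa>\<^sup>2 * u t) * cs \<kappa> t)) (at t within {0..l})"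
      unfolding q_def
      by (intro has_vector_derivative_add has_vector_derivative_mult
          has_vector_derivative_mult_right u v that derivs)
    then show ?thesis by (simp add: algebra_simps)
  qed
  from primitive_of_derivative[OF this t] have q: "q t = 0" by (simp add: q_def u v)
  have "u t * ((cs \<kappa> t)\<^sup>2 + \<kappa>\<^sup>2 * (sn \<kappa> t)\<^sup>2) = p t * cs \<kappa> t + q t * sn \<kappa> t"
    "v t * ((cs \<kappa> t)\<^sup>2 + \<kappa>\<^sup>2 * (sn \<kappa> t)\<^sup>2) = q t * cs \<kappa> t - \<kappa>\<^sup>2 * p t * sn \<kappa> t"
    by (simp_all add: p_def q_def algebra_simps power2_eq_square)
  then show "u t = 0" "v t = 0" by (simp_all add: p q cs_sn_square[OF assms(1)])
qed

lemma edge_system_unique: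
  assumes "\<kappa> \<noteq> 0" "sqint l g" and sys: "edge_system l \<kappa> g u u'" and t: "t \<in> {0..l}"
  shows "u t = edge_sol \<kappa> g (u 0) (u' 0) t" "u' t = edge_sol_deriv \<kappa> g (u 0) (u' 0) t"
proof -
  let ?v = "edge_sol \<kappa> g (u 0) (u' 0)" and ?v' = "edge_sol_deriv \<kappa> g (u 0) (u' 0)"
  note du = edge_system_has_vector_derivative[OF sys]
    and dv = edge_system_has_vector_derivative[OF edge_system_edge_sol[OF assms(1,2)]]
  have diff: "((\<lambda>t. u t - ?v t) has_vector_derivative u' t - ?v' t) (at t within {0..l})"
    "((\<lambda>t. u' t - ?v' t) has_vector_derivative - (\<kappa>\<^sup>2 * (u t - ?v t))) (at t within {0..l})"
    if "t \<in> {0..l}" for t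
    using has_vector_derivative_diff[OF du(1)[OF that] dv(1)[OF that, of "u 0" "u' 0"]]
      has_vector_derivative_diff[OF du(2)[OF that] dv(2)[OF that, of "u 0" "u' 0"]]
    by (simp_all add: algebra_simps)
  show "u t = ?v t" "u' t = ?v' t"
    using harmonic_oscillator_unique[OF assms(1) diff(1) _ diff(2) _ t] by simp_all
qed

lemma continuous_on_interval_bounded:
  fixes f :: "real \<Rightarrow> 'a::real_normed_vector"
  assumes "continuous_on {a..b} f"
  obtains M where "M > 0" "\<And>t. t \<in> {a..b} \<Longrightarrow> norm (f t) \<le> M"
  using compact_imp_bounded[OF compact_continuous_image[OF assms compact_Icc]]
  by (auto simp: bounded_pos)

lemma norm_mult_le: "norm x \<le> p \<Longrightarrow> norm y \<le> q \<Longrightarrow> norm (x * y) \<le> p * q"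
  for x y :: "'a::real_normed_algebra"
  by (rule order_trans[OF norm_mult_ineq]) (auto intro!: mult_mono order_trans[OF norm_ge_zero])

lemma cs_sn_bounded:
  obtains M where "M > 0" "\<And>t. t \<in> {c..d} \<Longrightarrow> cmod (cs \<kappa> t) \<le> M" "\<And>t. t \<in> {c..d} \<Longrightarrow> cmod (sn \<kappa> t) \<le> M"
proof -
  obtain M where "M > 0" and M: "\<And>t. t \<in> {c..d} \<Longrightarrow> norm (cs \<kappa> t, sn \<kappa> t) \<le> M"
    using continuous_on_interval_bounded[OF continuous_on_Pair[OF continuous_on_cs continuous_on_sn]]
    by blast
  have "cmod (cs \<kappa> t) \<le> M" "cmod (sn \<kappa> t) \<le> M" if "t \<in> {c..d}" for t
    using M[OF that] norm_fst_le[of "cs \<kappa> t" "sn \<kappa> t"] norm_snd_le[of "sn \<kappa> t" "cs \<kappa> t"]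
    by (simp_all add: order_trans)
  with \<open>M > 0\<close> show thesis by (rule that)
qed

lemma amplitude_bound:
  assumes trig: "\<And>t. t \<in> {0..l} \<Longrightarrow> cmod (cs \<kappa> t) \<le> M" "\<And>t. t \<in> {0..l} \<Longrightarrow> cmod (sn \<kappa> t) \<le> M"
    and g: "g integrable_on {0..l}" "\<And>s. s \<in> {0..l} \<Longrightarrow> cmod (primitive g s) \<le> R"
    and t: "t \<in> {0..l}"
  shows "cmod (cs_amplitude \<kappa> g \<alpha> t) \<le> cmod \<alpha> + l * (M * R)"
    and "cmod (sn_amplitude \<kappa> g \<beta> t) \<le> cmod \<beta> + (cmod \<kappa>)\<^sup>2 * (l * (M * R))"
proof -
  have integral_le: "cmod (primitive (\<lambda>s. f s * primitive g s) t) \<le> l * (M * R)"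
    if "continuous_on {0..l} f" "\<And>s. s \<in> {0..l} \<Longrightarrow> cmod (f s) \<le> M" for f
    by (rule norm_primitive_le[OF _ _ t])
      (auto intro!: continuous_intros continuous_on_primitive norm_mult_le that g)
  show "cmod (cs_amplitude \<kappa> g \<alpha> t) \<le> cmod \<alpha> + l * (M * R)"
    unfolding cs_amplitude_def
    by (rule order_trans[OF norm_triangle_ineq4])
      (intro add_mono integral_le continuous_on_cs trig order_refl)
  have "cmod (\<kappa>\<^sup>2) \<le> (cmod \<kappa>)\<^sup>2" by (simp add: norm_power)
  then show "cmod (sn_amplitude \<kappa> g \<beta> t) \<le> cmod \<beta> + (cmod \<kappa>)\<^sup>2 * (l * (M * R))"
    unfolding sn_amplitude_def
    by (intro order_trans[OF norm_triangle_ineq4] add_mono norm_mult_le integral_le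
        continuous_on_sn trig order_refl)
qed

lemma edge_sol_sup_bound:
  assumes "l > 0"
  obtains D where
    "\<And>g \<alpha> \<beta> R t. g integrable_on {0..l} \<Longrightarrow> (\<And>s. s \<in> {0..l} \<Longrightarrow> cmod (primitive g s) \<le> R) \<Longrightarrow>
      t \<in> {0..l} \<Longrightarrow> max (cmod (edge_sol \<kappa> g \<alpha> \<beta> t)) (cmod (edge_sol_deriv \<kappa> g \<alpha> \<beta> t))
        \<le> D * (cmod \<alpha> + cmod \<beta> + R)"
proof -
  obtain M where M: "M > 0"
    and trig: "\<And>t. t \<in> {0..l} \<Longrightarrow> cmod (cs \<kappa> t) \<le> M" "\<And>t. t \<in> {0..l} \<Longrightarrow> cmod (sn \<kappa> t) \<le> M"
    using cs_sn_bounded by blast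
  define m q D where "m = (cmod \<kappa>)\<^sup>2" and "q = 1 + l * M + m * (l * M)"
    and "D = 2 * (1 + m) * M * q + 1"
  have nonneg: "0 \<le> m" "0 \<le> q" using M assms by (simp_all add: m_def q_def)
  have "max (cmod (edge_sol \<kappa> g \<alpha> \<beta> t)) (cmod (edge_sol_deriv \<kappa> g \<alpha> \<beta> t))
      \<le> D * (cmod \<alpha> + cmod \<beta> + R)"
    if g: "g integrable_on {0..l}" "\<And>s. s \<in> {0..l} \<Longrightarrow> cmod (primitive g s) \<le> R"
      and t: "t \<in> {0..l}" for g \<alpha> \<beta> R t
  proof -
    let ?N = "cmod \<alpha> + cmod \<beta> + R" and ?A = "cs_amplitude \<kappa> g \<alpha> t" and ?B = "sn_amplitude \<kappa> g \<beta> t"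
    have "0 \<le> R" using g(2)[OF t] norm_ge_zero order_trans by blast
    then have "cmod \<alpha> + l * (M * R) \<le> q * ?N" "cmod \<beta> + m * (l * (M * R)) \<le> q * ?N"
      using nonneg M assms by (simp_all add: q_def algebra_simps)
    then have amplitudes: "cmod ?A \<le> q * ?N" "cmod ?B \<le> q * ?N"
      using amplitude_bound[OF trig g t] by (auto simp: m_def intro: order_trans)
    have "cmod (edge_sol \<kappa> g \<alpha> \<beta> t) \<le> q * ?N * M + q * ?N * M"
      unfolding edge_sol_def
      by (intro order_trans[OF norm_triangle_ineq] add_mono norm_mult_le amplitudes trig t)
    also have "\<dots> \<le> D * ?N"
      using nonneg M \<open>0 \<le> R\<close> by (simp add: D_def algebra_simps)
    finally have sol: "cmod (edge_sol \<kappa> g \<alpha> \<beta> t) \<le> D * ?N" .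
    have "cmod (- (\<kappa>\<^sup>2 * (?A * sn \<kappa> t))) \<le> m * (q * ?N * M)"
      unfolding norm_minus_cancel
      by (intro norm_mult_le amplitudes trig t) (simp add: m_def norm_power)
    then have "cmod (edge_sol_deriv \<kappa> g \<alpha> \<beta> t) \<le> m * (q * ?N * M) + q * ?N * M + R"
      unfolding edge_sol_deriv_def
      by (intro order_trans[OF norm_triangle_ineq4] order_trans[OF norm_triangle_ineq] add_mono
          norm_mult_le amplitudes trig t g(2))
    also have "\<dots> \<le> D * ?N"
      using nonneg M \<open>0 \<le> R\<close> by (simp add: D_def algebra_simps)
    finally show ?thesis using sol by simp
  qed
  then show thesis by (rule that)
qed

lemma power2_sum3_le: "(x + y + z)\<^sup>2 \<le> 3 * (x\<^sup>2 + y\<^sup>2 + z\<^sup>2)" for x y z :: real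
  using sum_squares_bound[of x y] sum_squares_bound[of x z] sum_squares_bound[of y z]
  by (simp add: power2_eq_square algebra_simps)

lemma edge_sol_bound:
  assumes "l > 0"
  obtains K where
    "\<And>g \<alpha> \<beta> t. sqint l g \<Longrightarrow> t \<in> {0..l} \<Longrightarrow>
      (cmod (edge_sol \<kappa> g \<alpha> \<beta> t))\<^sup>2 \<le> K * (edge_norm2 l g + (cmod \<alpha>)\<^sup>2 + (cmod \<beta>)\<^sup>2)"
    "\<And>g \<alpha> \<beta> t. sqint l g \<Longrightarrow> t \<in> {0..l} \<Longrightarrow>
      (cmod (edge_sol_deriv \<kappa> g \<alpha> \<beta> t))\<^sup>2 \<le> K * (edge_norm2 l g + (cmod \<alpha>)\<^sup>2 + (cmod \<beta>)\<^sup>2)"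
proof -
  obtain D where D: "\<And>g \<alpha> \<beta> R t. g integrable_on {0..l} \<Longrightarrow>
      (\<And>s. s \<in> {0..l} \<Longrightarrow> cmod (primitive g s) \<le> R) \<Longrightarrow> t \<in> {0..l} \<Longrightarrow>
      max (cmod (edge_sol \<kappa> g \<alpha> \<beta> t)) (cmod (edge_sol_deriv \<kappa> g \<alpha> \<beta> t)) \<le> D * (cmod \<alpha> + cmod \<beta> + R)"
    using edge_sol_sup_bound[OF assms] by metis
  define K where "K = D\<^sup>2 * (3 * (1 + l))"
  have max_square_le: "(max (cmod (edge_sol \<kappa> g \<alpha> \<beta> t)) (cmod (edge_sol_deriv \<kappa> g \<alpha> \<beta> t)))\<^sup>2
      \<le> K * (edge_norm2 l g + (cmod \<alpha>)\<^sup>2 + (cmod \<beta>)\<^sup>2)"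
    if g: "sqint l g" and t: "t \<in> {0..l}" for g \<alpha> \<beta> t
  proof -
    define R where "R = sqrt (l * edge_norm2 l g)"
    have R2: "R\<^sup>2 = l * edge_norm2 l g" using assms by (simp add: R_def edge_norm2_nonneg)
    have "cmod (primitive g s) \<le> R" if "s \<in> {0..l}" for s
      unfolding R_def by (rule real_le_rsqrt[OF primitive_square_le[OF g assms that]])
    from D[OF sqint_integrable_on[OF g] this t]
    have "(max (cmod (edge_sol \<kappa> g \<alpha> \<beta> t)) (cmod (edge_sol_deriv \<kappa> g \<alpha> \<beta> t)))\<^sup>2
        \<le> (D * (cmod \<alpha> + cmod \<beta> + R))\<^sup>2"
      by (intro power_mono max.coboundedI1[OF norm_ge_zero]) simp_all
    also have "\<dots> \<le> D\<^sup>2 * (3 * ((cmod \<alpha>)\<^sup>2 + (cmod \<beta>)\<^sup>2 + R\<^sup>2))"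
      unfolding power_mult_distrib by (intro mult_left_mono power2_sum3_le) simp
    also have "\<dots> \<le> D\<^sup>2 * (3 * ((1 + l) * (edge_norm2 l g + (cmod \<alpha>)\<^sup>2 + (cmod \<beta>)\<^sup>2)))"
      using assms edge_norm2_nonneg[of l g]
      by (intro mult_left_mono) (simp_all add: R2 algebra_simps)
    finally show ?thesis by (simp only: K_def mult.assoc)
  qed
  show thesis
  proof (rule that[of K])
    fix g \<alpha> \<beta> t assume "sqint l g" "t \<in> {0..l}"
    note max_le = max_square_le[OF this, of \<alpha> \<beta>]
    show "(cmod (edge_sol \<kappa> g \<alpha> \<beta> t))\<^sup>2 \<le> K * (edge_norm2 l g + (cmod \<alpha>)\<^sup>2 + (cmod \<beta>)\<^sup>2)"
      by (rule order_trans[OF power_mono[OF max.cobounded1 norm_ge_zero] max_le])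
    show "(cmod (edge_sol_deriv \<kappa> g \<alpha> \<beta> t))\<^sup>2 \<le> K * (edge_norm2 l g + (cmod \<alpha>)\<^sup>2 + (cmod \<beta>)\<^sup>2)"
      by (rule order_trans[OF power_mono[OF max.cobounded2 norm_ge_zero] max_le])
  qed
qed

lemma edge_norm2_edge_sol_le:
  assumes "\<kappa> \<noteq> 0" "l > 0"
  obtains K where "\<And>g \<alpha> \<beta>. sqint l g \<Longrightarrow>
    edge_norm2 l (edge_sol \<kappa> g \<alpha> \<beta>) \<le> K * (edge_norm2 l g + (cmod \<alpha>)\<^sup>2 + (cmod \<beta>)\<^sup>2)"
proof -
  obtain K where "\<And>g \<alpha> \<beta> t. sqint l g \<Longrightarrow> t \<in> {0..l} \<Longrightarrow>
      (cmod (edge_sol \<kappa> g \<alpha> \<beta> t))\<^sup>2 \<le> K * (edge_norm2 l g + (cmod \<alpha>)\<^sup>2 + (cmod \<beta>)\<^sup>2)"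
    using edge_sol_bound[OF assms(2)] by metis
  then show thesis
    using edge_norm2_le_const[OF _ continuous_on_edge_sol[OF assms(1)]] assms(2)
    by (intro that[of "l * K"]) (simp add: mult.assoc)
qed

text \<open>A cubic Hermite basis function. It is the test function in the bound for the right end value
  of a solution and, being the solution for \<open>hermite_source\<close>, the response to a source that acts on
  one vertex only.\<close>

definition hermite :: "real \<Rightarrow> real \<Rightarrow> complex" where
  "hermite l t = of_real (t^3 / l\<^sup>2 - t\<^sup>2 / l)"

definition hermite_deriv :: "real \<Rightarrow> real \<Rightarrow> complex" where
  "hermite_deriv l t = of_real (3 * t\<^sup>2 / l\<^sup>2 - 2 * t / l)"

definition hermite_deriv2 :: "real \<Rightarrow> real \<Rightarrow> complex" where
  "hermite_deriv2 l t = of_real (6 * t / l\<^sup>2 - 2 / l)"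

lemma hermite_has_vector_derivative:
  "(hermite l has_vector_derivative hermite_deriv l t) (at t within S)"
  "(hermite_deriv l has_vector_derivative hermite_deriv2 l t) (at t within S)"
  unfolding hermite_def[abs_def] hermite_deriv_def[abs_def] hermite_deriv2_def
  by (rule has_vector_derivative_of_real,
      (auto intro!: derivative_eq_intros simp: divide_inverse)[1])+

lemma hermite_boundary_values:
  assumes "l > 0"
  shows "hermite l 0 = 0" "hermite l l = 0" "hermite_deriv l 0 = 0" "hermite_deriv l l = 1"
  using assms
  by (simp_all add: hermite_def hermite_deriv_def field_simps power2_eq_square power3_eq_cube)

lemma continuous_on_hermite:
  "continuous_on S (hermite l)" "continuous_on S (hermite_deriv l)"
  "continuous_on S (hermite_deriv2 l)"
  unfolding hermite_def[abs_def] hermite_deriv_def[abs_def] hermite_deriv2_def[abs_def] divide_inverse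
  by (intro continuous_intros)+

definition hermite_source :: "complex \<Rightarrow> real \<Rightarrow> real \<Rightarrow> complex" where
  "hermite_source \<kappa> l t = - (hermite_deriv2 l t + \<kappa>\<^sup>2 * hermite l t)"

lemma continuous_on_hermite_source: "continuous_on S (hermite_source \<kappa> l)"
  unfolding hermite_source_def[abs_def] by (intro continuous_intros continuous_on_hermite)

lemma edge_system_hermite: "edge_system l \<kappa> (hermite_source \<kappa> l) (hermite l) (hermite_deriv l)"
  unfolding edge_system_def
proof (intro ballI conjI hermite_has_vector_derivative)
  fix t assume "t \<in> {0..l}"
  from has_vector_derivative_add[OF hermite_has_vector_derivative(2)[of l]
      primitive_has_vector_derivative[OF continuous_on_hermite_source[of _ \<kappa> l] this]]
  show "((\<lambda>s. hermite_deriv l s + primitive (hermite_source \<kappa> l) s) has_vector_derivative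
      - (\<kappa>\<^sup>2 * hermite l t)) (at t within {0..l})"
    by (simp add: hermite_source_def)
qed

text \<open>Green's formula for \<open>u\<close> and \<open>hermite l\<close>.\<close>

lemma edge_system_endpoint_eq:
  assumes "l > 0" and sys: "edge_system l \<kappa> g u u'"
  shows "u l = - primitive (\<lambda>t. u t * hermite_source \<kappa> l t + primitive g t * hermite_deriv l t) l"
proof -
  let ?v = "hermite l" and ?v' = "hermite_deriv l" and ?G = "primitive g"
  have "((\<lambda>t. u t * ?v' t - (u' t + ?G t) * ?v t) has_vector_derivative
      - (u t * hermite_source \<kappa> l t + ?G t * ?v' t)) (at t within {0..l})" if t: "t \<in> {0..l}" for t
  proof -
    have "((\<lambda>t. u t * ?v' t - (u' t + ?G t) * ?v t) has_vector_derivative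
      (u t * hermite_deriv2 l t + u' t * ?v' t) - ((u' t + ?G t) * ?v' t + - (\<kappa>\<^sup>2 * u t) * ?v t))
      (at t within {0..l})"
      by (intro has_vector_derivative_diff has_vector_derivative_mult
          hermite_has_vector_derivative edge_system_has_vector_derivative[OF sys t])
    then show ?thesis by (simp add: hermite_source_def algebra_simps)
  qed
  from primitive_of_derivative[OF this, of l] show ?thesis
    using assms(1) by (simp only: primitive_uminus) (simp add: hermite_boundary_values)
qed

lemma primitive_mult_square_le:
  assumes "l > 0" "continuous_on {0..l} u" "continuous_on {0..l} k" "\<And>t. t \<in> {0..l} \<Longrightarrow> cmod (k t) \<le> M"
  shows "(cmod (primitive (\<lambda>t. u t * k t) l))\<^sup>2 \<le> l * (M\<^sup>2 * edge_norm2 l u)"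
proof -
  have cont: "continuous_on {0..l} (\<lambda>t. u t * k t)" by (intro continuous_intros assms)
  have "(cmod (primitive (\<lambda>t. u t * k t) l))\<^sup>2 \<le> l * edge_norm2 l (\<lambda>t. u t * k t)"
    using assms(1) by (intro primitive_square_le sqint_continuous cont) simp_all
  also have "edge_norm2 l (\<lambda>t. u t * k t) \<le> M\<^sup>2 * edge_norm2 l u"
    using assms(4) by (intro edge_norm2_mono sqint_continuous cont assms(2))
      (auto simp: norm_mult power_mult_distrib mult.commute[of "M\<^sup>2"]
        intro!: mult_left_mono power_mono)
  finally show ?thesis using assms(1) by simp
qed

lemma edge_norm2_primitive_le:
  assumes "l > 0" "sqint l g"
  shows "edge_norm2 l (primitive g) \<le> l\<^sup>2 * edge_norm2 l g"
  using edge_norm2_le_const[OF _ continuous_on_primitive[OF sqint_integrable_on[OF assms(2)]]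
      primitive_square_le[OF assms(2,1)]] assms(1)
  by (simp add: power2_eq_square mult.assoc)

lemma edge_system_endpoint_bound:
  assumes "l > 0"
  obtains K where "\<And>g u u'. sqint l g \<Longrightarrow> edge_system l \<kappa> g u u' \<Longrightarrow>
    (cmod (u l))\<^sup>2 \<le> K * (edge_norm2 l u + edge_norm2 l g)"
proof -
  let ?s = "hermite_source \<kappa> l" and ?v' = "hermite_deriv l"
  obtain A where A: "\<And>t. t \<in> {0..l} \<Longrightarrow> cmod (?s t) \<le> A"
    using continuous_on_interval_bounded[OF continuous_on_hermite_source] by blast
  obtain B where B: "\<And>t. t \<in> {0..l} \<Longrightarrow> cmod (?v' t) \<le> B"
    using continuous_on_interval_bounded[OF continuous_on_hermite(2)] by blast
  have "(cmod (u l))\<^sup>2 \<le> 2 * (l * (A\<^sup>2 + B\<^sup>2 * l\<^sup>2)) * (edge_norm2 l u + edge_norm2 l g)"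
    if g: "sqint l g" and sys: "edge_system l \<kappa> g u u'" for g u u'
  proof -
    let ?G = "primitive g"
    note u = edge_system_continuous_on[OF sys]
    note G = continuous_on_primitive[OF sqint_integrable_on[OF g]]
    have "primitive (\<lambda>t. u t * ?s t + ?G t * ?v' t) l
        = primitive (\<lambda>t. u t * ?s t) l + primitive (\<lambda>t. ?G t * ?v' t) l"
      unfolding primitive_def[of _ l]
      by (intro Henstock_Kurzweil_Integration.integral_add integrable_continuous_interval
          continuous_intros u G continuous_on_hermite continuous_on_hermite_source)
    then have "(cmod (u l))\<^sup>2 \<le> 2 * ((cmod (primitive (\<lambda>t. u t * ?s t) l))\<^sup>2
        + (cmod (primitive (\<lambda>t. ?G t * ?v' t) l))\<^sup>2)"
      unfolding edge_system_endpoint_eq[OF assms sys] norm_minus_cancel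
      by (simp only: cmod_add_square_le)
    also have "\<dots> \<le> 2 * (l * (A\<^sup>2 * edge_norm2 l u) + l * (B\<^sup>2 * edge_norm2 l ?G))"
      by (intro mult_left_mono add_mono primitive_mult_square_le assms u G A B
          continuous_on_hermite continuous_on_hermite_source) simp_all
    also have "\<dots> \<le> 2 * (l * ((A\<^sup>2 + B\<^sup>2 * l\<^sup>2) * edge_norm2 l u)
        + l * ((A\<^sup>2 + B\<^sup>2 * l\<^sup>2) * edge_norm2 l g))"
    proof -
      have "B\<^sup>2 * edge_norm2 l ?G \<le> B\<^sup>2 * (l\<^sup>2 * edge_norm2 l g)"
        by (rule mult_left_mono[OF edge_norm2_primitive_le[OF assms g]]) simp
      also have "\<dots> \<le> (A\<^sup>2 + B\<^sup>2 * l\<^sup>2) * edge_norm2 l g"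
        unfolding mult.assoc[symmetric] by (intro mult_right_mono edge_norm2_nonneg) simp
      finally show ?thesis
        using assms by (intro mult_left_mono add_mono mult_right_mono edge_norm2_nonneg) simp_all
    qed
    also have "\<dots> = 2 * (l * (A\<^sup>2 + B\<^sup>2 * l\<^sup>2)) * (edge_norm2 l u + edge_norm2 l g)" by algebra
    finally show ?thesis .
  qed
  then show thesis by (rule that)
qed

subsection \<open>Square-summable solutions of the recurrence\<close>

definition ell2 :: "('i \<Rightarrow> complex) \<Rightarrow> bool" where
  "ell2 y \<longleftrightarrow> (\<lambda>j. (cmod (y j))\<^sup>2) summable_on UNIV"

lemma ell2_comparison:
  assumes "f summable_on UNIV" "\<And>j. (cmod (y j))\<^sup>2 \<le> f j"
  shows "ell2 y"
  unfolding ell2_def by (rule summable_on_comparison_test[OF assms(1)]) (use assms(2) in auto)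

lemma ell2_zero: "ell2 (\<lambda>_. 0)"
  by (simp add: ell2_def)

lemma ell2_add: "ell2 x \<Longrightarrow> ell2 y \<Longrightarrow> ell2 (\<lambda>j. x j + y j)"
  unfolding ell2_def
  by (rule ell2_comparison[unfolded ell2_def, OF _ cmod_add_square_le])
    (intro summable_on_cmult_right summable_on_add)

lemma ell2_cmult: "ell2 x \<Longrightarrow> ell2 (\<lambda>j. c * x j)"
  unfolding ell2_def norm_mult power_mult_distrib by (rule summable_on_cmult_right)

lemma ell2_uminus: "ell2 x \<Longrightarrow> ell2 (\<lambda>j. - x j)"
  by (simp add: ell2_def)

lemma ell2_diff: "ell2 x \<Longrightarrow> ell2 y \<Longrightarrow> ell2 (\<lambda>j. x j - y j)"
  using ell2_add[OF _ ell2_uminus] by simp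

lemma ell2_divide: "ell2 x \<Longrightarrow> ell2 (\<lambda>j. x j / c)"
  using ell2_cmult[of x "1 / c"] by simp

lemma ell2_shift:
  fixes x :: "'i::ab_group_add \<Rightarrow> complex"
  shows "ell2 x \<Longrightarrow> ell2 (\<lambda>j. x (j + k))"
  using summable_on_reindex_bij_betw[of "\<lambda>j. j + k" UNIV UNIV "\<lambda>j. (cmod (x j))\<^sup>2"]
  by (simp add: ell2_def bij_plus_right)

lemma ell2_tendsto_0:
  fixes \<phi> :: "nat \<Rightarrow> 'i"
  assumes "ell2 y" and inj: "inj \<phi>"
  shows "(\<lambda>n. y (\<phi> n)) \<longlonglongrightarrow> 0"
proof -
  have "(\<lambda>j. (cmod (y j))\<^sup>2) summable_on range \<phi>"
    using assms(1) unfolding ell2_def by (rule summable_on_subset_banach) simp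
  then have "summable (\<lambda>n. (cmod (y (\<phi> n)))\<^sup>2)"
    by (intro summable_on_imp_summable) (simp add: summable_on_reindex[OF inj] comp_def)
  then have "(\<lambda>n. (cmod (y (\<phi> n)))\<^sup>2) \<longlonglongrightarrow> 0" by (rule summable_LIMSEQ_zero)
  from tendsto_real_sqrt[OF this] show ?thesis by (simp add: tendsto_norm_zero_cancel)
qed

lemma Cauchy_Schwarz_infsum:
  fixes w x :: "'a \<Rightarrow> real"
  assumes nonneg: "\<And>i. 0 \<le> w i" "\<And>i. 0 \<le> x i"
    and w: "w summable_on A" and wx2: "(\<lambda>i. w i * (x i)\<^sup>2) summable_on A"
  shows "(\<lambda>i. w i * x i) summable_on A"
    and "(\<Sum>\<^sub>\<infinity>i\<in>A. w i * x i)\<^sup>2 \<le> (\<Sum>\<^sub>\<infinity>i\<in>A. w i) * (\<Sum>\<^sub>\<infinity>i\<in>A. w i * (x i)\<^sup>2)"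
proof -
  define B where "B = sqrt ((\<Sum>\<^sub>\<infinity>i\<in>A. w i) * (\<Sum>\<^sub>\<infinity>i\<in>A. w i * (x i)\<^sup>2))"
  have B: "(\<Sum>i\<in>F. w i * x i) \<le> B" if F: "finite F" "F \<subseteq> A" for F
  proof -
    have "(\<Sum>i\<in>F. w i * x i)\<^sup>2 = (\<Sum>i\<in>F. sqrt (w i) * (sqrt (w i) * x i))\<^sup>2"
      by (simp add: nonneg mult.assoc[symmetric])
    also have "\<dots> \<le> (\<Sum>i\<in>F. (sqrt (w i))\<^sup>2) * (\<Sum>i\<in>F. (sqrt (w i) * x i)\<^sup>2)"
      by (rule Cauchy_Schwarz_ineq_sum)
    also have "\<dots> = (\<Sum>i\<in>F. w i) * (\<Sum>i\<in>F. w i * (x i)\<^sup>2)"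
      by (simp add: nonneg power_mult_distrib)
    also have "\<dots> \<le> (\<Sum>\<^sub>\<infinity>i\<in>A. w i) * (\<Sum>\<^sub>\<infinity>i\<in>A. w i * (x i)\<^sup>2)"
      by (intro mult_mono finite_sum_le_infsum w wx2 F infsum_nonneg sum_nonneg)
        (simp_all add: nonneg)
    finally show ?thesis unfolding B_def by (rule real_le_rsqrt)
  qed
  show summable: "(\<lambda>i. w i * x i) summable_on A"
    by (rule nonneg_bdd_above_summable_on) (use B nonneg in \<open>auto intro!: bdd_aboveI[of _ B]\<close>)
  have "(\<Sum>\<^sub>\<infinity>i\<in>A. w i * x i)\<^sup>2 \<le> B\<^sup>2"
    by (intro power_mono infsum_le_finite_sums summable B infsum_nonneg) (simp_all add: nonneg)
  then show "(\<Sum>\<^sub>\<infinity>i\<in>A. w i * x i)\<^sup>2 \<le> (\<Sum>\<^sub>\<infinity>i\<in>A. w i) * (\<Sum>\<^sub>\<infinity>i\<in>A. w i * (x i)\<^sup>2)"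
    by (simp add: B_def nonneg infsum_nonneg)
qed

lemma Young_ell1_ell2:
  fixes G h :: "'i::ab_group_add \<Rightarrow> complex"
  assumes G: "(\<lambda>m. cmod (G m)) summable_on UNIV" and h: "ell2 h"
  shows "(\<lambda>m. G m * h (j - m)) summable_on UNIV"
    and "ell2 (\<lambda>j. \<Sum>\<^sub>\<infinity>m. G m * h (j - m))"
proof -
  define f where "f m j = cmod (G m) * (cmod (h (j - m)))\<^sup>2" for m j
  have "(\<lambda>(m, j). f m j) summable_on UNIV \<times> UNIV"
  proof (rule summable_on_SigmaI)
    fix m
    have "((\<lambda>j. (cmod (h (j - m)))\<^sup>2) has_sum (\<Sum>\<^sub>\<infinity>j. (cmod (h j))\<^sup>2)) UNIV"
      using h has_sum_reindex_bij_betw[of "\<lambda>j. j - m" UNIV UNIV "\<lambda>j. (cmod (h j))\<^sup>2"]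
      by (simp add: ell2_def bij_diff_right)
    from has_sum_cmult_right[OF this]
    show "((\<lambda>j. case (m, j) of (m, j) \<Rightarrow> f m j) has_sum
        (cmod (G m) * (\<Sum>\<^sub>\<infinity>j. (cmod (h j))\<^sup>2))) UNIV"
      by (simp add: f_def)
  qed (use summable_on_cmult_left[OF G] in \<open>auto simp: f_def\<close>)
  then have swapped: "(\<lambda>(j, m). f m j) summable_on UNIV \<times> UNIV"
    by (subst summable_on_swap) (simp add: case_prod_unfold)
  have row: "(\<lambda>m. f m j) summable_on UNIV" for j by (rule summable_on_SigmaD1[OF swapped]) simp
  note cauchy_schwarz = Cauchy_Schwarz_infsum[of "\<lambda>m. cmod (G m)" "\<lambda>m. cmod (h (j - m))" UNIV for j,
      OF _ _ G row[unfolded f_def], simplified]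
  have abs_summable: "(\<lambda>m. norm (G m * h (j - m))) summable_on UNIV" for j
    by (simp add: norm_mult cauchy_schwarz(1))
  then show "(\<lambda>m. G m * h (j - m)) summable_on UNIV" by (rule abs_summable_summable)
  show "ell2 (\<lambda>j. \<Sum>\<^sub>\<infinity>m. G m * h (j - m))"
  proof (rule ell2_comparison)
    show "(\<lambda>j. (\<Sum>\<^sub>\<infinity>m. cmod (G m)) * (\<Sum>\<^sub>\<infinity>m. f m j)) summable_on UNIV"
      by (intro summable_on_cmult_right summable_on_Sigma_banach[OF swapped])
    fix j
    have "(cmod (\<Sum>\<^sub>\<infinity>m. G m * h (j - m)))\<^sup>2 \<le> (\<Sum>\<^sub>\<infinity>m. cmod (G m) * cmod (h (j - m)))\<^sup>2"
      using norm_infsum_bound[OF abs_summable] by (intro power_mono) (simp_all add: norm_mult)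
    also have "\<dots> \<le> (\<Sum>\<^sub>\<infinity>m. cmod (G m)) * (\<Sum>\<^sub>\<infinity>m. f m j)"
      unfolding f_def by (rule cauchy_schwarz(2))
    finally show "(cmod (\<Sum>\<^sub>\<infinity>m. G m * h (j - m)))\<^sup>2 \<le> (\<Sum>\<^sub>\<infinity>m. cmod (G m)) * (\<Sum>\<^sub>\<infinity>m. f m j)" .
  qed
qed

lemma summable_on_power_abs_int:
  fixes r :: real
  assumes "0 \<le> r" "r < 1"
  shows "(\<lambda>j::int. r ^ nat \<bar>j\<bar>) summable_on UNIV"
proof -
  have nat: "(\<lambda>n. r ^ n) summable_on UNIV"
    using assms by (subst summable_on_UNIV_nonneg_real_iff) (auto intro: summable_geometric)
  have "inj (\<lambda>n. - int n)" by (simp add: inj_on_def)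
  then have "(\<lambda>j. r ^ nat \<bar>j\<bar>) summable_on range int"
    "(\<lambda>j. r ^ nat \<bar>j\<bar>) summable_on range (\<lambda>n. - int n)"
    using nat by (simp_all add: summable_on_reindex comp_def)
  then have "(\<lambda>j. r ^ nat \<bar>j\<bar>) summable_on range int \<union> range (\<lambda>n. - int n)"
    by (rule summable_on_union)
  moreover have "j \<in> range int \<union> range (\<lambda>n. - int n)" for j
    by (cases j rule: int_cases2) auto
  ultimately show ?thesis by (metis UNIV_eq_I)
qed

lemma ell2_power_abs:
  assumes "cmod z < 1"
  shows "ell2 (\<lambda>j. z ^ nat \<bar>j\<bar>)"
  unfolding ell2_def norm_power power2_eq_square power_mult_distrib[symmetric]
  by (rule summable_on_power_abs_int) (use assms mult_strict_mono[of "cmod z" 1 "cmod z" 1] in auto)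

definition jacobi :: "(int \<Rightarrow> complex) \<Rightarrow> (int \<Rightarrow> complex) \<Rightarrow> int \<Rightarrow> complex" where
  "jacobi F y j = y (j + 1) + y (j - 1) - 2 * F j * y j"

lemma jacobi_add: "jacobi F (\<lambda>j. x j + y j) j = jacobi F x j + jacobi F y j"
  and jacobi_cmult: "jacobi F (\<lambda>j. c * y j) j = c * jacobi F y j"
  by (simp_all add: jacobi_def algebra_simps)

definition single_site :: "'a \<Rightarrow> 'a \<Rightarrow> int \<Rightarrow> 'a" where
  "single_site F F' j = (if j = 0 then F' else F)"

lemma single_site_const [simp]: "single_site F F = (\<lambda>_. F)"
  by (simp add: single_site_def fun_eq_iff)

lemma jacobi_power_abs:
  assumes "z \<noteq> 0" "z + 1/z = 2 * F"
  shows "jacobi (single_site F F') (\<lambda>j. z ^ nat \<bar>j\<bar>) j = (if j = 0 then 2 * (z - F') else 0)"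
proof -
  have step: "z ^ Suc (Suc n) + z ^ n - 2 * F * z ^ Suc n = 0" for n
    unfolding assms(2)[symmetric] using assms(1) by (simp add: field_simps)
  consider "j = 0" | "j > 0" | "j < 0" by linarith
  then show ?thesis
  proof cases
    case 1
    then show ?thesis by (simp add: jacobi_def single_site_def algebra_simps)
  next
    case 2
    then have "nat \<bar>j + 1\<bar> = Suc (Suc (nat (j - 1)))" "nat \<bar>j - 1\<bar> = nat (j - 1)"
      "nat \<bar>j\<bar> = Suc (nat (j - 1))" by auto
    then show ?thesis using 2 step by (simp only: jacobi_def single_site_def) simp
  next
    case 3
    then have "nat \<bar>j - 1\<bar> = Suc (Suc (nat (- j - 1)))" "nat \<bar>j + 1\<bar> = nat (- j - 1)"
      "nat \<bar>j\<bar> = Suc (nat (- j - 1))" by auto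
    then show ?thesis
      using 3 step[of "nat (- j - 1)"]
      by (simp only: jacobi_def single_site_def) (simp add: algebra_simps)
  qed
qed

lemma jacobi_convolution:
  assumes "\<And>j. (\<lambda>m. G m * h (j - m)) summable_on UNIV"
  shows "jacobi (\<lambda>_. F) (\<lambda>j. \<Sum>\<^sub>\<infinity>m. G m * h (j - m)) j = (\<Sum>\<^sub>\<infinity>m. jacobi (\<lambda>_. F) G m * h (j - m))"
proof -
  have "((\<lambda>m. G (m + k) * h (j - m)) has_sum (\<Sum>\<^sub>\<infinity>m. G m * h (j + k - m))) UNIV" for k
    using has_sum_reindex_bij_betw[of "\<lambda>m. m + k" UNIV UNIV "\<lambda>m. G m * h (j + k - m)"]
      assms[of "j + k"]
    by (simp add: bij_plus_right)
  from has_sum_add[OF has_sum_add[OF this[of 1] this[of "-1"]]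
      has_sum_cmult_right[OF this[of 0], of "- 2 * F"]]
  have "((\<lambda>m. jacobi (\<lambda>_. F) G m * h (j - m)) has_sum
      jacobi (\<lambda>_. F) (\<lambda>j. \<Sum>\<^sub>\<infinity>m. G m * h (j - m)) j) UNIV"
    by (simp add: jacobi_def algebra_simps)
  then show ?thesis by (rule infsumI[symmetric])
qed

lemma jacobi_const_surj:
  assumes z: "cmod z < 1" "z \<noteq> 0" "z + 1/z = 2 * F" and h: "ell2 h"
  obtains x where "ell2 x" "\<And>j. jacobi (\<lambda>_. F) x j = h j"
proof -
  have zF: "z - F \<noteq> 0"
  proof
    assume "z - F = 0"
    then have "z + 1/z = 2 * z" using z(3) by simp
    then have "z\<^sup>2 = 1" using z(2) by (simp add: field_simps power2_eq_square)
    with z(1) show False by (auto simp: power2_eq_1_iff)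
  qed
  define G where "G m = 1 / (2 * (z - F)) * z ^ nat \<bar>m\<bar>" for m :: int
  have "(\<lambda>m. cmod (G m)) summable_on UNIV"
    unfolding G_def norm_mult norm_power
    by (intro summable_on_cmult_right summable_on_power_abs_int) (use z in auto)
  note conv = Young_ell1_ell2[OF this h]
  have "jacobi (\<lambda>_. F) G m = (if m = 0 then 1 else 0)" for m
    unfolding G_def jacobi_cmult using jacobi_power_abs[OF z(2,3), of F m] zF by simp
  then have "jacobi (\<lambda>_. F) (\<lambda>j. \<Sum>\<^sub>\<infinity>m. G m * h (j - m)) j = h j" for j
    unfolding jacobi_convolution[OF conv(1)]
    by (intro infsumI has_sum_finite_neutralI[of "{0}"]) auto
  with conv(2) show thesis by (rule that)
qed

lemma jacobi_single_site_surj: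
  assumes z: "cmod z < 1" "z \<noteq> 0" "z + 1/z = 2 * F" and "F' \<noteq> z" and h: "ell2 h"
  obtains y where "ell2 y" "\<And>j. jacobi (single_site F F') y j = h j"
proof -
  obtain x where x: "ell2 x" "\<And>j. jacobi (\<lambda>_. F) x j = h j"
    using jacobi_const_surj[OF z h] by blast
  have perturbed: "jacobi (single_site F F') x j
      = h j + (if j = 0 then 2 * (F - F') * x 0 else 0)" for j
    using x(2)[of j] by (simp add: jacobi_def single_site_def algebra_simps)
  define c where "c = (F' - F) * x 0 / (z - F')"
  show thesis
  proof (rule that)
    show "ell2 (\<lambda>j. x j + c * z ^ nat \<bar>j\<bar>)" by (intro ell2_add ell2_cmult x ell2_power_abs z)
    show "jacobi (single_site F F') (\<lambda>j. x j + c * z ^ nat \<bar>j\<bar>) j = h j" for j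
      unfolding jacobi_add jacobi_cmult perturbed jacobi_power_abs[OF z(2,3)]
      using \<open>F' \<noteq> z\<close> by (simp add: c_def field_simps)
  qed
qed

lemma half_line_decaying_eq:
  fixes y :: "nat \<Rightarrow> complex"
  assumes z: "z \<noteq> 0" "cmod z \<le> 1"
    and rec: "\<And>n. y (Suc (Suc n)) + y n = (z + 1/z) * y (Suc n)" and lim: "y \<longlonglongrightarrow> 0"
  shows "y n = z ^ n * y 0"
proof -
  define w where "w n = y (Suc n) - z * y n" for n
  have w: "w n = z * w (Suc n)" for n
  proof -
    have "z * (y (Suc (Suc n)) + y n) = (z * z + 1) * y (Suc n)"
      unfolding rec using z(1) by (simp add: field_simps)
    then show ?thesis by (simp add: w_def algebra_simps)
  qed
  have "cmod (w n) \<le> cmod (w (Suc n))" for n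
    using mult_right_mono[OF z(2), of "cmod (w (Suc n))"] by (subst w) (simp add: norm_mult)
  then have mono: "incseq (\<lambda>n. cmod (w n))" by (rule incseq_SucI)
  have "w \<longlonglongrightarrow> 0 - z * 0"
    unfolding w_def[abs_def] by (intro tendsto_intros LIMSEQ_Suc lim)
  then have "(\<lambda>n. cmod (w n)) \<longlonglongrightarrow> 0" by (simp add: tendsto_norm_zero)
  from incseq_le[OF mono this] have "w n = 0" for n by simp
  then have "y (Suc n) = z * y n" for n by (simp add: w_def)
  then show ?thesis by (induction n) simp_all
qed

lemma jacobi_decaying_eq:
  assumes z: "z \<noteq> 0" "cmod z \<le> 1" "z + 1/z = 2 * F" and "ell2 y"
    and rec: "\<And>j. j \<noteq> 0 \<Longrightarrow> jacobi (single_site F F') y j = 0"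
  shows "y j = z ^ nat \<bar>j\<bar> * y 0"
proof -
  have rec': "y (j + 1) + y (j - 1) = (z + 1/z) * y j" if "j \<noteq> 0" for j
    using rec[OF that] that by (simp add: jacobi_def single_site_def z(3))
  have right: "y (int n) = z ^ n * y (int 0)" for n
  proof (rule half_line_decaying_eq[OF z(1,2)])
    show "(\<lambda>n. y (int n)) \<longlonglongrightarrow> 0" by (rule ell2_tendsto_0[OF \<open>ell2 y\<close>]) simp
    show "y (int (Suc (Suc n))) + y (int n) = (z + 1/z) * y (int (Suc n))" for n
      using rec'[of "int (Suc n)"] by (simp add: algebra_simps)
  qed
  have left: "y (- int n) = z ^ n * y (- int 0)" for n
  proof (rule half_line_decaying_eq[OF z(1,2)])
    show "(\<lambda>n. y (- int n)) \<longlonglongrightarrow> 0" by (rule ell2_tendsto_0[OF \<open>ell2 y\<close>]) (simp add: inj_on_def)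
    show "y (- int (Suc (Suc n))) + y (- int n) = (z + 1/z) * y (- int (Suc n))" for n
      using rec'[of "- int (Suc n)"] by (simp add: algebra_simps)
  qed
  show ?thesis
    using right[of "nat j"] left[of "nat (- j)"] by (cases "0 \<le> j") simp_all
qed

lemma jacobi_single_site_kernel:
  assumes z: "z \<noteq> 0" "cmod z \<le> 1" "z + 1/z = 2 * F" and "ell2 y"
    and rec: "\<And>j. jacobi (single_site F F') y j = 0"
  shows "y j = z ^ nat \<bar>j\<bar> * y 0" and "(z - F') * y 0 = 0"
proof -
  show y: "y j = z ^ nat \<bar>j\<bar> * y 0" for j by (rule jacobi_decaying_eq[OF assms])
  show "(z - F') * y 0 = 0"
    using rec[of 0] y[of 1] y[of "-1"] by (simp add: jacobi_def single_site_def algebra_simps)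
qed

lemma jacobi_band_point_source:
  assumes z: "cmod z = 1" "z + 1/z = 2 * F" and "ell2 y"
    and rec: "\<And>j. jacobi (\<lambda>_. F) y j = (if j = 0 then s else 0)"
  shows "s = 0"
proof -
  have "z \<noteq> 0" using z(1) by auto
  have y: "y j = z ^ nat \<bar>j\<bar> * y 0" for j
    by (rule jacobi_decaying_eq[where F' = F, OF \<open>z \<noteq> 0\<close> _ z(2) \<open>ell2 y\<close>]) (simp_all add: z(1) rec)
  have "(\<lambda>n. cmod (y (int n))) \<longlonglongrightarrow> 0"
    by (intro tendsto_norm_zero ell2_tendsto_0[OF \<open>ell2 y\<close>]) simp
  moreover have "cmod (y (int n)) = cmod (y 0)" for n
    using y[of "int n"] z(1) by (simp add: norm_mult norm_power)
  ultimately have "y 0 = 0" by (simp add: LIMSEQ_const_iff)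
  then have "y j = 0" for j using y[of j] by simp
  then show "s = 0" using rec[of 0] by (simp add: jacobi_def)
qed

subsection \<open>Reduction of the graph equation to the recurrence\<close>

definition discriminant :: "real \<Rightarrow> real \<Rightarrow> real \<Rightarrow> real \<Rightarrow> complex \<Rightarrow> complex" where
  "discriminant a b \<tau> \<gamma> \<kappa> =
     of_real \<gamma> * sn \<kappa> a / 2 + cs \<kappa> a + sn \<kappa> a * (cs \<kappa> b - of_real \<tau>) / sn \<kappa> b"

type_synonym graph_fun = "int \<Rightarrow> etype \<Rightarrow> real \<Rightarrow> complex"

lemma elen_simps [simp]: "elen a b Hor = a" "elen a b Up = b/2" "elen a b Dn = b/2"
  by (simp_all add: elen_def)

lemma L2g_iff:
  "L2g a b g \<longleftrightarrow> (\<forall>j e. sqint (elen a b e) (g j e)) \<and>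
     (\<forall>e. (\<lambda>j. edge_norm2 (elen a b e) (g j e)) summable_on UNIV)"
proof -
  let ?N = "\<lambda>j. edge_norm2 a (g j Hor) + edge_norm2 (b/2) (g j Up) + edge_norm2 (b/2) (g j Dn)"
  have "?N summable_on UNIV \<longleftrightarrow> (\<forall>e. (\<lambda>j. edge_norm2 (elen a b e) (g j e)) summable_on UNIV)"
  proof (intro iffI allI)
    fix e assume "?N summable_on UNIV"
    then show "(\<lambda>j. edge_norm2 (elen a b e) (g j e)) summable_on UNIV"
      by (rule summable_on_comparison_test) (cases e; simp add: edge_norm2_nonneg)+
  next
    assume "\<forall>e. (\<lambda>j. edge_norm2 (elen a b e) (g j e)) summable_on UNIV"
    from this[rule_format, of Hor] this[rule_format, of Up] this[rule_format, of Dn]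
    show "?N summable_on UNIV" by (intro summable_on_add) simp_all
  qed
  then show ?thesis by (simp add: L2g_def)
qed

lemma L2g_zero: "L2g a b (\<lambda>_ _ _. 0)"
  by (simp add: L2g_iff sqint_continuous edge_norm2_def)

locale comb =
  fixes a b \<theta> :: real and \<kappa> :: complex
  assumes a_pos: "a > 0" and b_pos: "b > 0"
    and sin_a: "sin (\<kappa> * of_real a) \<noteq> 0" and sin_b: "sin (\<kappa> * of_real b) \<noteq> 0"
begin

abbreviation \<omega> :: complex where
  "\<omega> \<equiv> exp (\<i> * complex_of_real \<theta>)"

abbreviation F :: "real \<Rightarrow> complex" where
  "F \<gamma> \<equiv> discriminant a b (cos \<theta>) \<gamma> \<kappa>"

lemma \<kappa>_nz: "\<kappa> \<noteq> 0"
  using sin_a by auto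

lemma sn_a_nz: "sn \<kappa> a \<noteq> 0" and sn_b_nz: "sn \<kappa> b \<noteq> 0"
  using sin_a sin_b \<kappa>_nz by (auto simp: sn_def)

lemma omega_sum: "\<omega> + 1 / \<omega> = 2 * of_real (cos \<theta>)"
  by (simp add: cos_of_real[symmetric] cos_exp_eq exp_minus inverse_eq_divide)

lemma elen_pos: "elen a b e > 0"
  using a_pos b_pos by (cases e) auto

text \<open>The state at the start of the lower edge is the state at the end of the upper edge divided by
  \<open>\<omega>\<close>; \<open>loop_end\<close> and \<open>loop_end_deriv\<close> give the state after running through both.\<close>

definition loop_end :: "graph_fun \<Rightarrow> int \<Rightarrow> complex \<Rightarrow> complex \<Rightarrow> complex" where
  "loop_end g j \<alpha> \<beta> = edge_sol \<kappa> (g j Dn)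
     (edge_sol \<kappa> (g j Up) \<alpha> \<beta> (b/2) / \<omega>) (edge_sol_deriv \<kappa> (g j Up) \<alpha> \<beta> (b/2) / \<omega>) (b/2)"

definition loop_end_deriv :: "graph_fun \<Rightarrow> int \<Rightarrow> complex \<Rightarrow> complex \<Rightarrow> complex" where
  "loop_end_deriv g j \<alpha> \<beta> = edge_sol_deriv \<kappa> (g j Dn)
     (edge_sol \<kappa> (g j Up) \<alpha> \<beta> (b/2) / \<omega>) (edge_sol_deriv \<kappa> (g j Up) \<alpha> \<beta> (b/2) / \<omega>) (b/2)"

lemma loop_end_superposition:
  "loop_end g j \<alpha> \<beta> = loop_end g j 0 0 + (\<alpha> * cs \<kappa> b + \<beta> * sn \<kappa> b) / \<omega>"
  "loop_end_deriv g j \<alpha> \<beta> = loop_end_deriv g j 0 0 + (\<beta> * cs \<kappa> b - \<kappa>\<^sup>2 * \<alpha> * sn \<kappa> b) / \<omega>"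
proof -
  have double: "cs \<kappa> b = cs \<kappa> (b/2) * cs \<kappa> (b/2) - \<kappa>\<^sup>2 * sn \<kappa> (b/2) * sn \<kappa> (b/2)"
    "sn \<kappa> b = sn \<kappa> (b/2) * cs \<kappa> (b/2) + cs \<kappa> (b/2) * sn \<kappa> (b/2)"
    using cs_add[OF \<kappa>_nz, of "b/2" "b/2"] sn_add[of \<kappa> "b/2" "b/2"]
    by (simp_all only: field_sum_of_halves)
  note up = edge_sol_superposition[of \<kappa> "g j Up" \<alpha> \<beta> "b/2"]
  note dn = edge_sol_superposition[of \<kappa> "g j Dn" "edge_sol \<kappa> (g j Up) x y (b/2) / \<omega>"
      "edge_sol_deriv \<kappa> (g j Up) x y (b/2) / \<omega>" "b/2" for x y]
  show "loop_end g j \<alpha> \<beta> = loop_end g j 0 0 + (\<alpha> * cs \<kappa> b + \<beta> * sn \<kappa> b) / \<omega>"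
    "loop_end_deriv g j \<alpha> \<beta> = loop_end_deriv g j 0 0 + (\<beta> * cs \<kappa> b - \<kappa>\<^sup>2 * \<alpha> * sn \<kappa> b) / \<omega>"
    unfolding loop_end_def loop_end_deriv_def dn unfolding up double
    by (simp_all add: add_divide_distrib diff_divide_distrib algebra_simps)
qed

text \<open>Shooting: the value at the end depends affinely on the initial slope.\<close>

definition hor_slope :: "graph_fun \<Rightarrow> (int \<Rightarrow> complex) \<Rightarrow> int \<Rightarrow> complex" where
  "hor_slope g y j = (y j - edge_sol \<kappa> (g j Hor) (y (j - 1)) 0 a) / sn \<kappa> a"

definition up_slope :: "graph_fun \<Rightarrow> (int \<Rightarrow> complex) \<Rightarrow> int \<Rightarrow> complex" where
  "up_slope g y j = \<omega> * (y j - loop_end g j (y j) 0) / sn \<kappa> b"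

lemma edge_sol_end_eq_iff: "edge_sol \<kappa> (g j Hor) (y (j - 1)) \<beta> a = y j \<longleftrightarrow> \<beta> = hor_slope g y j"
  using edge_sol_superposition(1)[of \<kappa> "g j Hor" "y (j - 1)" \<beta> a]
    edge_sol_superposition(1)[of \<kappa> "g j Hor" "y (j - 1)" 0 a] sn_a_nz
  by (auto simp: hor_slope_def field_simps)

lemma loop_end_eq_iff: "loop_end g j (y j) \<beta> = y j \<longleftrightarrow> \<beta> = up_slope g y j"
  using loop_end_superposition(1)[of g j "y j" \<beta>] loop_end_superposition(1)[of g j "y j" 0] sn_b_nz
  by (auto simp: up_slope_def field_simps)

primrec init_value ::
  "graph_fun \<Rightarrow> (int \<Rightarrow> complex) \<Rightarrow> int \<Rightarrow> etype \<Rightarrow> complex" where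
  "init_value g y j Hor = y (j - 1)"
| "init_value g y j Up = y j"
| "init_value g y j Dn = edge_sol \<kappa> (g j Up) (y j) (up_slope g y j) (b/2) / \<omega>"

primrec init_slope ::
  "graph_fun \<Rightarrow> (int \<Rightarrow> complex) \<Rightarrow> int \<Rightarrow> etype \<Rightarrow> complex" where
  "init_slope g y j Hor = hor_slope g y j"
| "init_slope g y j Up = up_slope g y j"
| "init_slope g y j Dn = edge_sol_deriv \<kappa> (g j Up) (y j) (up_slope g y j) (b/2) / \<omega>"

definition graph_sol ::
  "graph_fun \<Rightarrow> (int \<Rightarrow> complex) \<Rightarrow> int \<Rightarrow> etype \<Rightarrow> real \<Rightarrow> complex" where
  "graph_sol g y j e = edge_sol \<kappa> (g j e) (init_value g y j e) (init_slope g y j e)"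

definition graph_sol_deriv ::
  "graph_fun \<Rightarrow> (int \<Rightarrow> complex) \<Rightarrow> int \<Rightarrow> etype \<Rightarrow> real \<Rightarrow> complex" where
  "graph_sol_deriv g y j e = edge_sol_deriv \<kappa> (g j e) (init_value g y j e) (init_slope g y j e)"

lemma edge_system_graph_sol:
  "sqint (elen a b e) (g j e) \<Longrightarrow>
    edge_system (elen a b e) \<kappa> (g j e) (graph_sol g y j e) (graph_sol_deriv g y j e)"
  unfolding graph_sol_def graph_sol_deriv_def by (rule edge_system_edge_sol[OF \<kappa>_nz])

lemma graph_sol_boundary_values:
  "graph_sol g y j Hor 0 = y (j - 1)" "graph_sol g y j Hor a = y j"
  "graph_sol g y j Up 0 = y j" "graph_sol g y j Dn (b/2) = y j"
  "graph_sol g y j Up (b/2) = \<omega> * graph_sol g y j Dn 0"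
  "graph_sol_deriv g y j Up (b/2) = \<omega> * graph_sol_deriv g y j Dn 0"
  using edge_sol_end_eq_iff[of g j y "hor_slope g y j"] loop_end_eq_iff[of g j y "up_slope g y j"]
  by (simp_all add: graph_sol_def graph_sol_deriv_def loop_end_def)

definition flux :: "graph_fun \<Rightarrow> (int \<Rightarrow> complex) \<Rightarrow> int \<Rightarrow> complex" where
  "flux g y j = - graph_sol_deriv g y j Hor a + graph_sol_deriv g y (j + 1) Hor 0
     + graph_sol_deriv g y j Up 0 - graph_sol_deriv g y j Dn (b/2)"

definition source :: "graph_fun \<Rightarrow> int \<Rightarrow> complex" where
  "source g j = - (sn \<kappa> a * flux g (\<lambda>_. 0) j)"

lemma hor_dirichlet_to_neumann:
  "graph_sol_deriv g y j Hor 0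
    = graph_sol_deriv g (\<lambda>_. 0) j Hor 0 + (y j - y (j - 1) * cs \<kappa> a) / sn \<kappa> a"
  "graph_sol_deriv g y j Hor a
    = graph_sol_deriv g (\<lambda>_. 0) j Hor a + (y j * cs \<kappa> a - y (j - 1)) / sn \<kappa> a"
proof -
  have slope: "hor_slope g y j = hor_slope g (\<lambda>_. 0) j + (y j - y (j - 1) * cs \<kappa> a) / sn \<kappa> a"
    unfolding hor_slope_def edge_sol_superposition(1)[of \<kappa> "g j Hor" "y (j - 1)" 0 a]
    by (simp add: diff_divide_distrib add_divide_distrib)
  then show "graph_sol_deriv g y j Hor 0
      = graph_sol_deriv g (\<lambda>_. 0) j Hor 0 + (y j - y (j - 1) * cs \<kappa> a) / sn \<kappa> a"
    by (simp add: graph_sol_deriv_def)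
  have "graph_sol_deriv g y j Hor a - graph_sol_deriv g (\<lambda>_. 0) j Hor a
      = (y j - y (j - 1) * cs \<kappa> a) / sn \<kappa> a * cs \<kappa> a - \<kappa>\<^sup>2 * y (j - 1) * sn \<kappa> a"
    unfolding graph_sol_deriv_def edge_sol_superposition(2)[of \<kappa> "g j Hor" "init_value g _ j Hor"]
    by (simp add: slope algebra_simps)
  also have "\<dots> = (y j * cs \<kappa> a - y (j - 1) * ((cs \<kappa> a)\<^sup>2 + \<kappa>\<^sup>2 * (sn \<kappa> a)\<^sup>2)) / sn \<kappa> a"
    using sn_a_nz by (simp add: field_simps power2_eq_square)
  also have "\<dots> = (y j * cs \<kappa> a - y (j - 1)) / sn \<kappa> a" by (simp add: cs_sn_square[OF \<kappa>_nz])
  finally show "graph_sol_deriv g y j Hor a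
      = graph_sol_deriv g (\<lambda>_. 0) j Hor a + (y j * cs \<kappa> a - y (j - 1)) / sn \<kappa> a"
    by (simp add: algebra_simps)
qed

lemma loop_dirichlet_to_neumann:
  "graph_sol_deriv g y j Up 0
    = graph_sol_deriv g (\<lambda>_. 0) j Up 0 + y j * (\<omega> - cs \<kappa> b) / sn \<kappa> b"
  "graph_sol_deriv g y j Dn (b/2)
    = graph_sol_deriv g (\<lambda>_. 0) j Dn (b/2) + y j * (cs \<kappa> b - 1 / \<omega>) / sn \<kappa> b"
proof -
  have slope: "up_slope g y j = up_slope g (\<lambda>_. 0) j + y j * (\<omega> - cs \<kappa> b) / sn \<kappa> b"
    unfolding up_slope_def loop_end_superposition(1)[of g j "y j" 0]
    using sn_b_nz by (simp add: field_simps)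
  then show "graph_sol_deriv g y j Up 0
      = graph_sol_deriv g (\<lambda>_. 0) j Up 0 + y j * (\<omega> - cs \<kappa> b) / sn \<kappa> b"
    by (simp add: graph_sol_deriv_def)
  have "graph_sol_deriv g y j Dn (b/2) - graph_sol_deriv g (\<lambda>_. 0) j Dn (b/2)
      = loop_end_deriv g j (y j) (up_slope g y j) - loop_end_deriv g j 0 (up_slope g (\<lambda>_. 0) j)"
    by (simp add: graph_sol_deriv_def loop_end_deriv_def)
  also have "\<dots> = (y j * (\<omega> - cs \<kappa> b) / sn \<kappa> b * cs \<kappa> b - \<kappa>\<^sup>2 * y j * sn \<kappa> b) / \<omega>"
    unfolding loop_end_superposition(2)[of g j _ "up_slope g _ j"]
    by (simp add: slope add_divide_distrib diff_divide_distrib distrib_right)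
  also have "\<dots> = y j * (\<omega> * cs \<kappa> b - ((cs \<kappa> b)\<^sup>2 + \<kappa>\<^sup>2 * (sn \<kappa> b)\<^sup>2)) / sn \<kappa> b / \<omega>"
    using sn_b_nz by (simp add: field_simps power2_eq_square)
  also have "\<dots> = y j * (cs \<kappa> b - 1 / \<omega>) / sn \<kappa> b"
    unfolding cs_sn_square[OF \<kappa>_nz] by (simp add: field_simps)
  finally show "graph_sol_deriv g y j Dn (b/2)
      = graph_sol_deriv g (\<lambda>_. 0) j Dn (b/2) + y j * (cs \<kappa> b - 1 / \<omega>) / sn \<kappa> b"
    by (simp add: algebra_simps)
qed

lemma flux_eq_iff_jacobi:
  "flux g y j = of_real (c j) * y j \<longleftrightarrow> jacobi (\<lambda>j. F (c j)) y j = source g j"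
proof -
  have "flux g y j = flux g (\<lambda>_. 0) j + (y (j + 1) + y (j - 1) - 2 * cs \<kappa> a * y j) / sn \<kappa> a
      + y j * (\<omega> + 1 / \<omega> - 2 * cs \<kappa> b) / sn \<kappa> b"
    unfolding flux_def hor_dirichlet_to_neumann[of g y] loop_dirichlet_to_neumann[of g y]
    by (simp add: add_divide_distrib diff_divide_distrib algebra_simps)
  also have "\<dots> - of_real (c j) * y j
      = flux g (\<lambda>_. 0) j + jacobi (\<lambda>j. F (c j)) y j / sn \<kappa> a"
    unfolding omega_sum using sn_a_nz sn_b_nz
    by (simp add: jacobi_def discriminant_def field_simps)
  finally have "flux g y j - of_real (c j) * y j = (jacobi (\<lambda>j. F (c j)) y j - source g j) / sn \<kappa> a"
    using sn_a_nz by (simp add: source_def field_simps)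
  then show ?thesis using sn_a_nz by auto
qed

lemma vertex_conds_graph_sol:
  assumes "\<And>j e. sqint (elen a b e) (g j e)"
  shows "vertex_conds a b c \<theta> (graph_sol g y) \<longleftrightarrow> (\<forall>j. jacobi (\<lambda>j. F (c j)) y j = source g j)"
proof -
  have "dv (elen a b e) (graph_sol g y j e) t = graph_sol_deriv g y j e t"
    if "t \<in> {0..elen a b e}" for j e t
    using edge_system_dv[OF edge_system_graph_sol[where g = g, OF assms] that elen_pos] .
  from this[of _ Hor] this[of _ Up] this[of _ Dn]
  have dv: "dv a (graph_sol g y j Hor) 0 = graph_sol_deriv g y j Hor 0"
    "dv a (graph_sol g y j Hor) a = graph_sol_deriv g y j Hor a"
    "dv (b/2) (graph_sol g y j Up) 0 = graph_sol_deriv g y j Up 0"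
    "dv (b/2) (graph_sol g y j Up) (b/2) = graph_sol_deriv g y j Up (b/2)"
    "dv (b/2) (graph_sol g y j Dn) 0 = graph_sol_deriv g y j Dn 0"
    "dv (b/2) (graph_sol g y j Dn) (b/2) = graph_sol_deriv g y j Dn (b/2)" for j
    using a_pos b_pos by simp_all
  show ?thesis
    unfolding vertex_conds_def flux_eq_iff_jacobi[symmetric]
    by (simp add: dv graph_sol_boundary_values flux_def)
qed

lemma vertex_conds_imp_graph_sol:
  assumes sq: "\<And>j e. sqint (elen a b e) (g j e)"
    and sys: "\<And>j e. edge_system (elen a b e) \<kappa> (g j e) (\<psi> j e) (dv (elen a b e) (\<psi> j e))"
    and V: "vertex_conds a b c \<theta> \<psi>"
  defines "y \<equiv> \<lambda>j. \<psi> j Up 0"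
  shows "t \<in> {0..elen a b e} \<Longrightarrow> \<psi> j e t = graph_sol g y j e t"
    and "jacobi (\<lambda>j. F (c j)) y j = source g j"
proof -
  let ?d = "\<lambda>j e. dv (elen a b e) (\<psi> j e)"
  have sol: "\<psi> j e t = edge_sol \<kappa> (g j e) (\<psi> j e 0) (?d j e 0) t"
    "?d j e t = edge_sol_deriv \<kappa> (g j e) (\<psi> j e 0) (?d j e 0) t" if "t \<in> {0..elen a b e}" for j e t
    using edge_system_unique[OF \<kappa>_nz sq sys that] .
  note sol_hor = sol[where e = Hor, simplified] and sol_up = sol[where e = Up, simplified]
    and sol_dn = sol[where e = Dn, simplified]
  note vertex = V[unfolded vertex_conds_def, rule_format]
  have start_hor: "\<psi> j Hor 0 = y (j - 1)" for j using vertex[of "j - 1"] by (simp add: y_def)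
  have slope_hor: "?d j Hor 0 = hor_slope g y j" for j
    using vertex[of j] sol_hor(1)[of a j] a_pos
    by (simp add: edge_sol_end_eq_iff[symmetric] start_hor y_def)
  have start_dn: "\<psi> j Dn 0 = \<psi> j Up (b/2) / \<omega>" "?d j Dn 0 = ?d j Up (b/2) / \<omega>" for j
    using vertex[of j] by simp_all
  have "\<psi> j Dn (b/2) = y j" for j using vertex[of j] by (simp add: y_def)
  then have "loop_end g j (y j) (?d j Up 0) = y j" for j
    using sol_dn(1)[of "b/2" j] sol_up[of "b/2" j] start_dn[of j] b_pos
    by (simp add: loop_end_def y_def)
  then have slope_up: "?d j Up 0 = up_slope g y j" for j by (simp only: loop_end_eq_iff)
  have init: "\<psi> j e 0 = init_value g y j e" "?d j e 0 = init_slope g y j e" for j e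
    using sol_up[of "b/2" j] start_hor slope_hor start_dn slope_up b_pos
    by (cases e; simp add: y_def)+
  show "\<psi> j e t = graph_sol g y j e t" if "t \<in> {0..elen a b e}" for t
    using sol(1)[OF that, of j] by (simp add: graph_sol_def init)
  have "?d j e t = graph_sol_deriv g y j e t" if "t \<in> {0..elen a b e}" for j e t
    using sol(2)[OF that, of j] by (simp add: graph_sol_deriv_def init)
  from this[of _ Hor] this[of _ Up] this[of _ Dn] have "flux g y j = of_real (c j) * y j"
    using vertex[of j] a_pos b_pos by (simp add: flux_def y_def)
  then show "jacobi (\<lambda>j. F (c j)) y j = source g j" by (simp add: flux_eq_iff_jacobi)
qed

lemma ell2_edge_sol:
  assumes "L2g a b g" "ell2 \<alpha>" "ell2 \<beta>" "t \<in> {0..elen a b e}"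
  shows "ell2 (\<lambda>j. edge_sol \<kappa> (g j e) (\<alpha> j) (\<beta> j) t)"
    and "ell2 (\<lambda>j. edge_sol_deriv \<kappa> (g j e) (\<alpha> j) (\<beta> j) t)"
proof -
  let ?l = "elen a b e"
  obtain K where K: "\<And>g \<alpha> \<beta> t. sqint ?l g \<Longrightarrow> t \<in> {0..?l} \<Longrightarrow>
      (cmod (edge_sol \<kappa> g \<alpha> \<beta> t))\<^sup>2 \<le> K * (edge_norm2 ?l g + (cmod \<alpha>)\<^sup>2 + (cmod \<beta>)\<^sup>2)"
    "\<And>g \<alpha> \<beta> t. sqint ?l g \<Longrightarrow> t \<in> {0..?l} \<Longrightarrow>
      (cmod (edge_sol_deriv \<kappa> g \<alpha> \<beta> t))\<^sup>2 \<le> K * (edge_norm2 ?l g + (cmod \<alpha>)\<^sup>2 + (cmod \<beta>)\<^sup>2)"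
    using edge_sol_bound[OF elen_pos] by metis
  have g: "sqint ?l (g j e)" for j using assms(1) by (simp add: L2g_iff)
  have "(\<lambda>j. K * (edge_norm2 ?l (g j e) + (cmod (\<alpha> j))\<^sup>2 + (cmod (\<beta> j))\<^sup>2)) summable_on UNIV"
    using assms(1-3) unfolding L2g_iff ell2_def
    by (intro summable_on_cmult_right summable_on_add) simp_all
  from ell2_comparison[OF this K(1)[OF g assms(4)]] ell2_comparison[OF this K(2)[OF g assms(4)]]
  show "ell2 (\<lambda>j. edge_sol \<kappa> (g j e) (\<alpha> j) (\<beta> j) t)"
    "ell2 (\<lambda>j. edge_sol_deriv \<kappa> (g j e) (\<alpha> j) (\<beta> j) t)" .
qed

lemma ell2_init:
  assumes g: "L2g a b g" and y: "ell2 y"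
  shows "ell2 (\<lambda>j. init_value g y j e)" "ell2 (\<lambda>j. init_slope g y j e)"
proof -
  have "a \<in> {0..elen a b Hor}" "b/2 \<in> {0..elen a b Up}" "b/2 \<in> {0..elen a b Dn}"
    using a_pos b_pos by simp_all
  note end_value = ell2_edge_sol(1)[OF g _ _ this(1)] ell2_edge_sol(1)[OF g _ _ this(2)]
    ell2_edge_sol(1)[OF g _ _ this(3)]
    and end_slope = ell2_edge_sol(2)[OF g _ _ this(2)]
  have y_left: "ell2 (\<lambda>j. y (j - 1))" using ell2_shift[OF y, of "- 1"] by simp
  have hor: "ell2 (hor_slope g y)"
    unfolding hor_slope_def[abs_def]
    by (intro ell2_divide ell2_diff end_value y y_left ell2_zero)
  have up: "ell2 (up_slope g y)"
    unfolding up_slope_def[abs_def] loop_end_def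
    by (intro ell2_divide ell2_cmult ell2_diff end_value end_slope y ell2_zero)
  show "ell2 (\<lambda>j. init_value g y j e)"
    by (cases e) (simp_all add: y y_left ell2_divide end_value up)
  show "ell2 (\<lambda>j. init_slope g y j e)"
    by (cases e) (simp_all add: y hor up ell2_divide end_slope)
qed

lemma ell2_source:
  assumes "L2g a b g"
  shows "ell2 (source g)"
proof -
  have slope: "ell2 (\<lambda>j. graph_sol_deriv g (\<lambda>_. 0) j e t)" if "t \<in> {0..elen a b e}" for e t
    unfolding graph_sol_deriv_def by (intro ell2_edge_sol(2) ell2_init assms ell2_zero that)
  have "ell2 (flux g (\<lambda>_. 0))"
    unfolding flux_def[abs_def]
    by (intro ell2_add ell2_diff ell2_uminus slope ell2_shift[OF slope]) (use a_pos b_pos in simp_all)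
  then show ?thesis unfolding source_def[abs_def] by (intro ell2_uminus ell2_cmult)
qed

lemma L2g_graph_sol:
  assumes g: "L2g a b g" and y: "ell2 y"
  shows "L2g a b (graph_sol g y)"
  unfolding L2g_iff
proof (intro conjI allI)
  have sq: "sqint (elen a b e) (g j e)" for j e using g by (simp add: L2g_iff)
  show "sqint (elen a b e) (graph_sol g y j e)" for j e
    by (intro sqint_continuous)
      (rule edge_system_continuous_on[OF edge_system_graph_sol[where g = g, OF sq]])
  fix e
  let ?l = "elen a b e"
  obtain K where K: "\<And>g \<alpha> \<beta>. sqint ?l g \<Longrightarrow>
      edge_norm2 ?l (edge_sol \<kappa> g \<alpha> \<beta>) \<le> K * (edge_norm2 ?l g + (cmod \<alpha>)\<^sup>2 + (cmod \<beta>)\<^sup>2)"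
    using edge_norm2_edge_sol_le[OF \<kappa>_nz elen_pos] by metis
  have "(\<lambda>j. K * (edge_norm2 ?l (g j e) + (cmod (init_value g y j e))\<^sup>2
      + (cmod (init_slope g y j e))\<^sup>2)) summable_on UNIV"
    using g ell2_init[OF g y] unfolding L2g_iff ell2_def
    by (intro summable_on_cmult_right summable_on_add) simp_all
  then show "(\<lambda>j. edge_norm2 ?l (graph_sol g y j e)) summable_on UNIV"
    by (rule summable_on_comparison_test) (simp_all add: graph_sol_def K sq edge_norm2_nonneg)
qed

lemma solves_graph_sol:
  assumes g: "L2g a b g" and y: "ell2 y" and rec: "\<And>j. jacobi (\<lambda>j. F (c j)) y j = source g j"
  shows "solves a b c \<theta> (\<kappa>\<^sup>2) (graph_sol g y) g"
proof -
  have sq: "sqint (elen a b e) (g j e)" for j e using g by (simp add: L2g_iff)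
  show ?thesis
    unfolding solves_def vertex_conds_graph_sol[OF sq]
    using L2g_graph_sol[OF g y] rec
      edge_system_imp_H2sol[OF sq edge_system_graph_sol[where g = g, OF sq]]
    by blast
qed

lemma solves_imp_graph_sol:
  assumes g: "L2g a b g" and sol: "solves a b c \<theta> (\<kappa>\<^sup>2) \<psi> g"
  defines "y \<equiv> \<lambda>j. \<psi> j Up 0"
  shows "t \<in> {0..elen a b e} \<Longrightarrow> \<psi> j e t = graph_sol g y j e t"
    and "jacobi (\<lambda>j. F (c j)) y j = source g j" and "ell2 y"
proof -
  have sq: "sqint (elen a b e) (g j e)" for j e using g by (simp add: L2g_iff)
  have V: "vertex_conds a b c \<theta> \<psi>" and L2: "L2g a b \<psi>" using sol by (simp_all add: solves_def)
  have sys: "edge_system (elen a b e) \<kappa> (g j e) (\<psi> j e) (dv (elen a b e) (\<psi> j e))" for j e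
    using sol by (intro H2sol_imp_edge_system[OF elen_pos sq]) (simp add: solves_def)
  show "t \<in> {0..elen a b e} \<Longrightarrow> \<psi> j e t = graph_sol g y j e t"
    "jacobi (\<lambda>j. F (c j)) y j = source g j"
    using vertex_conds_imp_graph_sol[OF sq sys V] by (simp_all add: y_def)
  obtain K where K: "\<And>g u u'. sqint a g \<Longrightarrow> edge_system a \<kappa> g u u' \<Longrightarrow>
      (cmod (u a))\<^sup>2 \<le> K * (edge_norm2 a u + edge_norm2 a g)"
    using edge_system_endpoint_bound[OF a_pos] by blast
  show "ell2 y"
  proof (rule ell2_comparison)
    show "(\<lambda>j. K * (edge_norm2 a (\<psi> j Hor) + edge_norm2 a (g j Hor))) summable_on UNIV"
      using g[unfolded L2g_iff, THEN conjunct2, rule_format, of Hor]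
        L2[unfolded L2g_iff, THEN conjunct2, rule_format, of Hor]
      by (intro summable_on_cmult_right summable_on_add) simp_all
    show "(cmod (y j))\<^sup>2 \<le> K * (edge_norm2 a (\<psi> j Hor) + edge_norm2 a (g j Hor))" for j
      using K[OF sq[of Hor, simplified] sys[of Hor, simplified]] V
      by (simp add: y_def vertex_conds_def)
  qed
qed

end

subsection \<open>The spectrum through the roots of \<open>z + 1/z = 2 F\<close>\<close>

context comb
begin

lemma discriminant_coup: "(\<lambda>j. F (coup \<gamma> \<gamma>t j)) = single_site (F \<gamma>) (F \<gamma>t)"
  by (auto simp: coup_def single_site_def)

lemma graph_sol_homogeneous_cmult:
  "graph_sol (\<lambda>_ _ _. 0) (\<lambda>j. x * y j) j e t = x * graph_sol (\<lambda>_ _ _. 0) y j e t"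
  by (cases e) (simp_all add: graph_sol_def edge_sol_homogeneous hor_slope_def up_slope_def
      loop_end_def algebra_simps)

lemma source_zero: "source (\<lambda>_ _ _. 0) j = 0"
  by (simp add: source_def flux_def graph_sol_deriv_def edge_sol_homogeneous hor_slope_def
      up_slope_def loop_end_def)

lemma homogeneous_solution_eq:
  assumes sol: "solves a b (coup \<gamma> \<gamma>t) \<theta> (\<kappa>\<^sup>2) \<psi> (\<lambda>_ _ _. 0)"
    and z: "z \<noteq> 0" "cmod z \<le> 1" "z + 1/z = 2 * F \<gamma>"
  shows "t \<in> {0..elen a b e} \<Longrightarrow> \<psi> j e t = \<psi> 0 Up 0 * graph_sol (\<lambda>_ _ _. 0) (\<lambda>j. z ^ nat \<bar>j\<bar>) j e t"
    and "(z - F \<gamma>t) * \<psi> 0 Up 0 = 0"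
proof -
  note vertex_values = solves_imp_graph_sol[OF L2g_zero sol, unfolded source_zero discriminant_coup]
  note kernel = jacobi_single_site_kernel[OF z vertex_values(3,2)]
  show "\<psi> j e t = \<psi> 0 Up 0 * graph_sol (\<lambda>_ _ _. 0) (\<lambda>j. z ^ nat \<bar>j\<bar>) j e t" if "t \<in> {0..elen a b e}"
    unfolding graph_sol_homogeneous_cmult[symmetric]
    using vertex_values(1)[OF that, of j] kernel(1) by (metis (no_types, lifting) ext mult.commute)
  show "(z - F \<gamma>t) * \<psi> 0 Up 0 = 0" by (rule kernel(2))
qed

lemma not_in_spectrum:
  assumes z: "z \<noteq> 0" "cmod z < 1" "z + 1/z = 2 * F \<gamma>" and "F \<gamma>t \<noteq> z"
  shows "\<kappa>\<^sup>2 \<notin> specH a b (coup \<gamma> \<gamma>t) \<theta>"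
proof -
  have "\<exists>\<psi>. solves a b (coup \<gamma> \<gamma>t) \<theta> (\<kappa>\<^sup>2) \<psi> g" if g: "L2g a b g" for g
  proof -
    obtain y where "ell2 y" "\<And>j. jacobi (single_site (F \<gamma>) (F \<gamma>t)) y j = source g j"
      using jacobi_single_site_surj[OF z(2,1,3) assms(4) ell2_source[OF g]] by metis
    then show ?thesis using solves_graph_sol[OF g, of y "coup \<gamma> \<gamma>t"] by (auto simp: discriminant_coup)
  qed
  moreover have "zero_on_edges a b \<psi>" if "solves a b (coup \<gamma> \<gamma>t) \<theta> (\<kappa>\<^sup>2) \<psi> (\<lambda>_ _ _. 0)" for \<psi>
    using homogeneous_solution_eq[OF that z(1) _ z(3)] z(2) assms(4) by (simp add: zero_on_edges_def)
  ultimately show ?thesis unfolding specH_def by blast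
qed

lemma eigenspace_one_dimensional:
  assumes z: "z \<noteq> 0" "cmod z < 1" "z + 1/z = 2 * F \<gamma>" and root: "F \<gamma>t = z"
  obtains \<phi> where "\<phi> \<in> eigsp a b (coup \<gamma> \<gamma>t) \<theta> (\<kappa>\<^sup>2)" "\<not> zero_on_edges a b \<phi>"
    "\<And>\<psi>. \<psi> \<in> eigsp a b (coup \<gamma> \<gamma>t) \<theta> (\<kappa>\<^sup>2) \<Longrightarrow>
      \<exists>x. \<forall>j e. \<forall>t\<in>{0..elen a b e}. \<psi> j e t = x * \<phi> j e t"
proof -
  define \<phi> where "\<phi> = graph_sol (\<lambda>_ _ _. 0) (\<lambda>j. z ^ nat \<bar>j\<bar>)"
  have "solves a b (coup \<gamma> \<gamma>t) \<theta> (\<kappa>\<^sup>2) \<phi> (\<lambda>_ _ _. 0)"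
    unfolding \<phi>_def
  proof (rule solves_graph_sol[OF L2g_zero ell2_power_abs[OF z(2)]])
    show "jacobi (\<lambda>j. F (coup \<gamma> \<gamma>t j)) (\<lambda>j. z ^ nat \<bar>j\<bar>) j = source (\<lambda>_ _ _. 0) j" for j
      by (simp add: discriminant_coup jacobi_power_abs[OF z(1,3)] root source_zero)
  qed
  then have "\<phi> \<in> eigsp a b (coup \<gamma> \<gamma>t) \<theta> (\<kappa>\<^sup>2)" by (simp add: eigsp_def)
  moreover have "\<phi> 0 Up 0 = 1" by (simp add: \<phi>_def graph_sol_boundary_values)
  then have "\<not> zero_on_edges a b \<phi>"
    using elen_pos[of Up]
    by (auto simp: zero_on_edges_def intro!: exI[of _ 0] exI[of _ Up] bexI[of _ 0])
  moreover have "\<exists>x. \<forall>j e. \<forall>t\<in>{0..elen a b e}. \<psi> j e t = x * \<phi> j e t"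
    if "\<psi> \<in> eigsp a b (coup \<gamma> \<gamma>t) \<theta> (\<kappa>\<^sup>2)" for \<psi>
  proof -
    have "solves a b (coup \<gamma> \<gamma>t) \<theta> (\<kappa>\<^sup>2) \<psi> (\<lambda>_ _ _. 0)" using that by (simp add: eigsp_def)
    from homogeneous_solution_eq(1)[OF this z(1) _ z(3)] z(2)
    show ?thesis unfolding \<phi>_def by (metis less_imp_le)
  qed
  ultimately show thesis by (rule that)
qed

lemma isolated_imp_in_discrete_spectrum:
  assumes z: "z \<noteq> 0" "cmod z < 1" "z + 1/z = 2 * F \<gamma>" and root: "F \<gamma>t = z"
    and isolated: "\<forall>\<^sub>F \<mu> in at (\<kappa>\<^sup>2). \<mu> \<notin> specH a b (coup \<gamma> \<gamma>t) \<theta>"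
  shows "\<kappa>\<^sup>2 \<in> disc_specH a b (coup \<gamma> \<gamma>t) \<theta>"
proof -
  let ?V = "eigsp a b (coup \<gamma> \<gamma>t) \<theta> (\<kappa>\<^sup>2)"
  obtain \<phi> where \<phi>: "\<phi> \<in> ?V" "\<not> zero_on_edges a b \<phi>"
    and dim: "\<And>\<psi>. \<psi> \<in> ?V \<Longrightarrow> \<exists>x. \<forall>j e. \<forall>t\<in>{0..elen a b e}. \<psi> j e t = x * \<phi> j e t"
    using eigenspace_one_dimensional[OF z root] by blast
  have "\<kappa>\<^sup>2 \<in> specH a b (coup \<gamma> \<gamma>t) \<theta>" using \<phi> by (auto simp: specH_def eigsp_def)
  moreover have "\<exists>\<epsilon>>0. \<forall>\<mu>. \<mu> \<noteq> \<kappa>\<^sup>2 \<and> cmod (\<mu> - \<kappa>\<^sup>2) < \<epsilon> \<longrightarrow> \<mu> \<notin> specH a b (coup \<gamma> \<gamma>t) \<theta>"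
    using isolated unfolding eventually_at dist_norm by blast
  moreover have "\<exists>V. finite V \<and> V \<subseteq> ?V \<and> (\<forall>\<psi>\<in>?V. \<exists>x. \<forall>j e. \<forall>t\<in>{0..elen a b e}.
      \<psi> j e t = (\<Sum>\<phi>\<in>V. x \<phi> * \<phi> j e t))"
  proof (intro exI[of _ "{\<phi>}"] conjI ballI)
    fix \<psi> assume "\<psi> \<in> ?V"
    from dim[OF this] obtain x where "\<forall>j e. \<forall>t\<in>{0..elen a b e}. \<psi> j e t = x * \<phi> j e t" by blast
    then show "\<exists>x. \<forall>j e. \<forall>t\<in>{0..elen a b e}. \<psi> j e t = (\<Sum>\<phi>\<in>{\<phi>}. x \<phi> * \<phi> j e t)"
      by (intro exI[of _ "\<lambda>_. x"]) simp
  qed (use \<phi> in simp_all)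
  ultimately show ?thesis using \<phi> unfolding disc_specH_def by blast
qed

definition point_source :: graph_fun where
  "point_source j e = (if j = 0 \<and> e = Dn then hermite_source \<kappa> (b/2) else (\<lambda>_. 0))"

lemma L2g_point_source: "L2g a b point_source"
  unfolding L2g_iff
proof (intro conjI allI)
  show "sqint (elen a b e) (point_source j e)" for j e
    by (simp add: point_source_def sqint_continuous continuous_on_hermite_source)
  show "(\<lambda>j. edge_norm2 (elen a b e) (point_source j e)) summable_on UNIV" for e
  proof (rule summable_on_cong_neutral[THEN iffD1])
    show "(\<lambda>j. edge_norm2 (elen a b e) (point_source j e)) summable_on {0}" by simp
    show "edge_norm2 (elen a b e) (point_source j e) = 0" if "j \<in> UNIV - {0}" for j
      using that by (simp add: point_source_def edge_norm2_def)
  qed auto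
qed

lemma source_point_source: "source point_source j = (if j = 0 then sn \<kappa> a else 0)"
proof -
  have "b/2 > 0" using b_pos by simp
  have "edge_sol \<kappa> (hermite_source \<kappa> (b/2)) 0 0 (b/2) = 0"
    "edge_sol_deriv \<kappa> (hermite_source \<kappa> (b/2)) 0 0 (b/2) = 1"
    using edge_system_unique[OF \<kappa>_nz sqint_continuous[OF continuous_on_hermite_source]
        edge_system_hermite, of "b/2" "b/2"] b_pos
    by (simp_all add: hermite_boundary_values[OF \<open>b/2 > 0\<close>])
  then show ?thesis
    by (simp add: source_def flux_def graph_sol_deriv_def point_source_def hor_slope_def up_slope_def
        loop_end_def edge_sol_homogeneous)
qed

lemma band_in_spectrum:
  assumes z: "cmod z = 1" "z + 1/z = 2 * F \<gamma>"
  shows "\<kappa>\<^sup>2 \<in> specH a b (coup \<gamma> \<gamma>) \<theta>"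
proof (rule ccontr)
  assume "\<kappa>\<^sup>2 \<notin> specH a b (coup \<gamma> \<gamma>) \<theta>"
  then obtain \<psi> where "solves a b (coup \<gamma> \<gamma>) \<theta> (\<kappa>\<^sup>2) \<psi> point_source"
    using L2g_point_source unfolding specH_def by blast
  note vertex_values = solves_imp_graph_sol[OF L2g_point_source this, unfolded source_point_source]
  have "jacobi (\<lambda>_. F \<gamma>) (\<lambda>j. \<psi> j Up 0) j = (if j = 0 then sn \<kappa> a else 0)" for j
    using vertex_values(2)[of j] by (simp add: coup_def)
  from jacobi_band_point_source[OF z vertex_values(3) this] show False using sn_a_nz by simp
qed

end

subsection \<open>Isolation of the eigenvalue\<close>

lemma discriminant_of_real:
  assumes "sin (k * b) \<noteq> 0"
  shows "discriminant a b \<tau> \<gamma> (of_real k) = of_real (ff a b \<gamma> \<tau> k)"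
proof -
  have "k \<noteq> 0" using assms by auto
  then have "ff a b \<gamma> \<tau> k = \<gamma> * (sin (k * a) / k) / 2 + cos (k * a)
      + (sin (k * a) / k) * (cos (k * b) - \<tau>) / (sin (k * b) / k)"
    using assms by (simp add: ff_def distrib_left sin_add field_simps)
  then show ?thesis
    unfolding discriminant_def cs_def sn_def of_real_mult[symmetric] sin_of_real cos_of_real by simp
qed

lemma sin_imaginary: "sin (\<i> * complex_of_real x) = \<i> * of_real (sinh x)"
  and cos_imaginary: "cos (\<i> * complex_of_real x) = of_real (cosh x)"
  by (simp_all add: sin_exp_eq cos_exp_eq sinh_field_def cosh_field_def exp_minus
      exp_of_real[symmetric] field_simps)

lemma discriminant_imaginary:
  assumes "t \<noteq> 0"
  shows "discriminant a b \<tau> \<gamma> (\<i> * of_real t) = of_real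
    (\<gamma> * sinh (a * t) / (2 * t) + cosh (a * t) + sinh (a * t) * (cosh (b * t) - \<tau>) / sinh (b * t))"
proof -
  have "cs (\<i> * of_real t) x = of_real (cosh (x * t))"
    "sn (\<i> * of_real t) x = of_real (sinh (x * t) / t)" for x
    unfolding cs_def sn_def mult.assoc of_real_mult[symmetric] sin_imaginary cos_imaginary
    by (simp_all add: mult.commute)
  then show ?thesis using assms by (simp add: discriminant_def)
qed

lemma discriminant_imaginary_asymptotics:
  assumes "a > 0" "b > 0"
  shows "((\<lambda>t. discriminant a b \<tau> \<gamma> (\<i> * of_real t) / of_real (cosh (a * t))) \<longlongrightarrow> 2) at_top"
proof -
  have lin: "filterlim (\<lambda>t. x * t) at_top at_top" if "x > 0" for x :: real
    by (rule filterlim_tendsto_pos_mult_at_top[OF tendsto_const that filterlim_ident])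
  have tanh: "((\<lambda>t. tanh (x * t)) \<longlongrightarrow> 1) at_top" if "x > 0" for x :: real
    by (rule filterlim_compose[OF tanh_real_at_top lin[OF that]])
  have "((\<lambda>t. \<tau> / sinh (b * t)) \<longlongrightarrow> 0) at_top"
    by (intro tendsto_divide_0[OF tendsto_const] filterlim_at_top_imp_at_infinity
        filterlim_compose[OF sinh_real_at_top] lin assms)
  moreover have "((\<lambda>t. \<gamma> * tanh (a * t) / (2 * t)) \<longlongrightarrow> 0) at_top"
    by (intro tendsto_divide_0[OF tendsto_mult[OF tendsto_const tanh]] assms
        filterlim_at_top_imp_at_infinity lin) simp
  ultimately have "((\<lambda>t. complex_of_real (\<gamma> * tanh (a * t) / (2 * t) + 1
      + tanh (a * t) * (1 / tanh (b * t) - \<tau> / sinh (b * t)))) \<longlongrightarrow>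
      of_real (0 + 1 + 1 * (1 / 1 - 0))) at_top"
    by (intro tendsto_intros tanh assms) simp_all
  moreover have "\<forall>\<^sub>F t in at_top. complex_of_real (\<gamma> * tanh (a * t) / (2 * t) + 1
      + tanh (a * t) * (1 / tanh (b * t) - \<tau> / sinh (b * t)))
      = discriminant a b \<tau> \<gamma> (\<i> * of_real t) / of_real (cosh (a * t))"
    using eventually_gt_at_top[of 0]
  proof eventually_elim
    case (elim t)
    then have "sinh (b * t) \<noteq> 0" using assms by simp
    then show ?case
      unfolding discriminant_imaginary[OF less_imp_neq[OF elim, symmetric]]
        of_real_divide[symmetric] of_real_eq_iff
      using elim by (simp add: tanh_def field_simps)
  qed
  ultimately show ?thesis by (simp add: tendsto_cong)
qed

definition secular :: "real \<Rightarrow> real \<Rightarrow> real \<Rightarrow> real \<Rightarrow> real \<Rightarrow> complex \<Rightarrow> complex" where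
  "secular a b \<tau> \<gamma> \<gamma>t \<kappa> = (discriminant a b \<tau> \<gamma>t \<kappa>)\<^sup>2
     - 2 * discriminant a b \<tau> \<gamma> \<kappa> * discriminant a b \<tau> \<gamma>t \<kappa> + 1"

lemma secular_eq_0:
  assumes "z \<noteq> 0" "z + 1/z = 2 * discriminant a b \<tau> \<gamma> \<kappa>" "discriminant a b \<tau> \<gamma>t \<kappa> = z"
  shows "secular a b \<tau> \<gamma> \<gamma>t \<kappa> = 0"
  unfolding secular_def assms(3) assms(2)[symmetric]
  using assms(1) by (simp add: field_simps power2_eq_square)

lemma secular_imaginary_nonzero:
  assumes "a > 0" "b > 0"
  obtains t where "t > 0" "secular a b \<tau> \<gamma> \<gamma>t (\<i> * of_real t) \<noteq> 0"
proof -
  let ?D = "\<lambda>\<gamma> t. discriminant a b \<tau> \<gamma> (\<i> * of_real t)" and ?c = "\<lambda>t. complex_of_real (cosh (a * t))"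
  have "filterlim (\<lambda>t. cosh (a * t)) at_top at_top"
    by (intro filterlim_compose[OF cosh_real_at_top]
        filterlim_tendsto_pos_mult_at_top[OF tendsto_const assms(1) filterlim_ident])
  then have "((\<lambda>t. 1 / cosh (a * t)) \<longlongrightarrow> 0) at_top"
    by (intro tendsto_divide_0[OF tendsto_const] filterlim_at_top_imp_at_infinity)
  from tendsto_of_real[OF this, where 'a = complex] have "((\<lambda>t. 1 / ?c t) \<longlongrightarrow> 0) at_top" by simp
  then have "((\<lambda>t. (?D \<gamma>t t / ?c t)\<^sup>2 - 2 * (?D \<gamma> t / ?c t) * (?D \<gamma>t t / ?c t) + (1 / ?c t)\<^sup>2)
      \<longlongrightarrow> 2\<^sup>2 - 2 * 2 * 2 + 0\<^sup>2) at_top"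
    by (intro tendsto_intros discriminant_imaginary_asymptotics assms)
  moreover have "(?D \<gamma>t t / ?c t)\<^sup>2 - 2 * (?D \<gamma> t / ?c t) * (?D \<gamma>t t / ?c t) + (1 / ?c t)\<^sup>2
      = secular a b \<tau> \<gamma> \<gamma>t (\<i> * of_real t) / (?c t)\<^sup>2" for t
    by (simp add: secular_def field_simps power2_eq_square)
  ultimately have "((\<lambda>t. secular a b \<tau> \<gamma> \<gamma>t (\<i> * of_real t) / (?c t)\<^sup>2) \<longlongrightarrow> - 4) at_top" by simp
  then have "\<forall>\<^sub>F t in at_top. secular a b \<tau> \<gamma> \<gamma>t (\<i> * of_real t) / (?c t)\<^sup>2 \<noteq> 0"
    by (rule tendsto_imp_eventually_ne) simp
  with eventually_gt_at_top[of 0]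
  have "\<forall>\<^sub>F t in at_top. t > 0 \<and> secular a b \<tau> \<gamma> \<gamma>t (\<i> * of_real t) \<noteq> 0"
    by eventually_elim simp
  from eventually_happens[OF this] show thesis using that by auto
qed

lemma eventually_secular_nonzero:
  assumes "a > 0" "b > 0" "sin (\<kappa>0 * of_real b) \<noteq> 0"
  shows "\<forall>\<^sub>F \<kappa> in at \<kappa>0. secular a b \<tau> \<gamma> \<gamma>t \<kappa> \<noteq> 0 \<and> sin (\<kappa> * of_real b) \<noteq> 0"
proof -
  define Z where "Z = {\<kappa>. sin (\<kappa> * complex_of_real b) = 0}"
  have "Z \<subseteq> range (\<lambda>n::int. complex_of_real (n * pi) / of_real b)"
    using assms(2) by (force simp: Z_def sin_eq_0 field_simps)
  then have "countable Z" by (rule countable_subset) simp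
  then have conn: "connected (- Z)"
    by (intro path_connected_imp_connected path_connected_complement_countable) simp
  have op: "open (- Z)"
    unfolding Z_def by (intro open_Compl closed_Collect_eq continuous_intros)
  have hol: "secular a b \<tau> \<gamma> \<gamma>t holomorphic_on - Z"
    unfolding secular_def[abs_def] discriminant_def cs_def sn_def
    by (intro holomorphic_intros) (auto simp: Z_def)
  obtain t where t: "t > 0" "secular a b \<tau> \<gamma> \<gamma>t (\<i> * of_real t) \<noteq> 0"
    using secular_imaginary_nonzero[OF assms(1,2)] by blast
  have "\<i> * of_real t \<in> - Z"
    using t(1) assms(2) by (simp add: Z_def mult.assoc sin_imaginary flip: of_real_mult)
  from non_zero_neighbour_alt[OF hol op conn _ this t(2)] show ?thesis
    using assms(3) by (simp add: Z_def)
qed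

lemma contracting_root_exists:
  assumes "F \<notin> complex_of_real ` {-1..1}"
  obtains z where "z \<noteq> 0" "cmod z < 1" "z + 1/z = 2 * F"
proof -
  define w where "w = F + csqrt (F\<^sup>2 - 1)"
  have "(w - F)\<^sup>2 = F\<^sup>2 - 1" by (simp add: w_def)
  then have prod: "w * (2 * F - w) = 1" by (simp add: power2_eq_square algebra_simps)
  then have "w \<noteq> 0" by auto
  moreover from this prod have "w + 1/w = 2 * F" by (simp add: field_simps)
  ultimately have w: "w \<noteq> 0" "w + 1/w = 2 * F" by simp_all
  consider "cmod w < 1" | "cmod w > 1" | "cmod w = 1" by linarith
  then show thesis
  proof cases
    case 1 with that w show ?thesis by blast
  next
    case 2
    then show ?thesis using that[of "1/w"] w by (simp add: norm_divide field_simps)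
  next
    case 3
    then have "1 / w = cnj w" using complex_div_cnj[of 1 w] by simp
    with w(2) have "F = of_real (Re w)" using complex_add_cnj[of w] by simp
    moreover have "\<bar>Re w\<bar> \<le> 1" using abs_Re_le_cmod[of w] 3 by simp
    ultimately show ?thesis using assms by (auto simp: abs_le_iff)
  qed
qed

lemma unimodular_root_exists:
  assumes "f \<in> {-1..1}"
  obtains z where "cmod z = 1" "z + 1/z = 2 * complex_of_real f"
proof -
  have "cis (arccos f) + 1 / cis (arccos f) = 2 * of_real f"
    using assms by (simp add: complex_eq_iff cis_divide[of 0, simplified])
  then show thesis by (intro that[of "cis (arccos f)"]) simp_all
qed

definition contracting_root :: "real \<Rightarrow> real" where
  "contracting_root f = (if f < -1 then f + sqrt (f\<^sup>2 - 1) else f - sqrt (f\<^sup>2 - 1))"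

lemma
  assumes "\<bar>f\<bar> > 1"
  shows contracting_root_nonzero: "contracting_root f \<noteq> 0"
    and abs_contracting_root_less_1: "\<bar>contracting_root f\<bar> < 1"
    and contracting_root_eq: "contracting_root f + 1 / contracting_root f = 2 * f"
proof -
  let ?z = "contracting_root f"
  define s where "s = sqrt (f\<^sup>2 - 1)"
  have "f\<^sup>2 > 1" using assms one_less_power[of "\<bar>f\<bar>" 2] by simp
  then have s: "s > 0" "s\<^sup>2 = f\<^sup>2 - 1" by (simp_all add: s_def)
  have prod: "?z * (2 * f - ?z) = 1"
    using s(2) unfolding contracting_root_def s_def[symmetric]
    by (auto simp: algebra_simps power2_eq_square)
  then show "?z \<noteq> 0" by auto
  with prod show "?z + 1 / ?z = 2 * f" by (simp add: field_simps)
  have "\<bar>2 * f - ?z\<bar> > 1" using s(1) assms by (auto simp: contracting_root_def s_def[symmetric])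
  moreover have "\<bar>?z\<bar> * \<bar>2 * f - ?z\<bar> = 1" using prod by (simp flip: abs_mult)
  ultimately show "\<bar>?z\<bar> < 1"
    using mult_le_less_imp_less[of 1 "\<bar>?z\<bar>" 1 "\<bar>2 * f - ?z\<bar>"] by (cases "\<bar>?z\<bar> < 1") simp_all
qed

lemma eventually_square_not_in_spectrum:
  assumes ab: "a > 0" "b > 0" and \<kappa>0: "sin (\<kappa>0 * of_real a) \<noteq> 0" "sin (\<kappa>0 * of_real b) \<noteq> 0"
    and gap: "discriminant a b (cos \<theta>) \<gamma> \<kappa>0 \<notin> of_real ` {-1..1}"
  shows "\<forall>\<^sub>F \<kappa> in at \<kappa>0. \<kappa>\<^sup>2 \<notin> specH a b (coup \<gamma> \<gamma>t) \<theta>"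
proof -
  let ?D = "discriminant a b (cos \<theta>) \<gamma>"
  have sin_a: "\<forall>\<^sub>F \<kappa> in at \<kappa>0. sin (\<kappa> * of_real a) \<noteq> 0"
    by (rule tendsto_imp_eventually_ne[OF _ \<kappa>0(1)]) (intro tendsto_intros)
  have "\<kappa>0 \<noteq> 0" using \<kappa>0(1) by auto
  then have "(?D \<longlongrightarrow> ?D \<kappa>0) (at \<kappa>0)"
    unfolding discriminant_def[abs_def] cs_def sn_def using \<kappa>0 by (intro tendsto_intros) auto
  moreover have "open (- (complex_of_real ` {-1..1}))"
    by (intro open_Compl compact_imp_closed compact_continuous_image continuous_intros) simp
  ultimately have "\<forall>\<^sub>F \<kappa> in at \<kappa>0. ?D \<kappa> \<in> - (of_real ` {-1..1})"
    using gap by (intro topological_tendstoD) simp_all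
  with sin_a eventually_secular_nonzero[OF ab \<kappa>0(2), of "cos \<theta>" \<gamma> \<gamma>t] show ?thesis
  proof eventually_elim
    case (elim \<kappa>)
    interpret comb a b \<theta> \<kappa> by unfold_locales (use ab elim in auto)
    obtain z where z: "z \<noteq> 0" "cmod z < 1" "z + 1/z = 2 * ?D \<kappa>"
      using contracting_root_exists elim(3) by blast
    show ?case using not_in_spectrum[OF z] secular_eq_0[OF z(1,3)] elim(2) by blast
  qed
qed

lemma eventually_at_square:
  assumes "Re \<kappa> > 0" and P: "\<forall>\<^sub>F w in at \<kappa>. P (w\<^sup>2)"
  shows "\<forall>\<^sub>F \<mu> in at (\<kappa>\<^sup>2). P \<mu>"
proof -
  have csqrt: "csqrt (\<kappa>\<^sup>2) = \<kappa>" using assms(1) by (intro csqrt_square) simp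
  have "filterlim csqrt (at \<kappa>) (at (\<kappa>\<^sup>2))"
  proof (rule filterlim_atI)
    have "\<kappa>\<^sup>2 \<notin> \<real>\<^sub>\<le>\<^sub>0"
    proof
      assume "\<kappa>\<^sup>2 \<in> \<real>\<^sub>\<le>\<^sub>0"
      then obtain x where "x \<le> 0" "\<kappa>\<^sup>2 = of_real x" by (auto simp: nonpos_Reals_def)
      then have "Re (csqrt (\<kappa>\<^sup>2)) = 0" by (simp add: csqrt_of_real_nonpos)
      with csqrt assms(1) show False by simp
    qed
    then have "isCont csqrt (\<kappa>\<^sup>2)" by (rule continuous_at_csqrt)
    then show "(csqrt \<longlongrightarrow> \<kappa>) (at (\<kappa>\<^sup>2))" by (simp add: isCont_def csqrt)
    have "csqrt \<mu> \<noteq> \<kappa>" if "\<mu> \<noteq> \<kappa>\<^sup>2" for \<mu> using that by (metis power2_csqrt)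
    then show "\<forall>\<^sub>F \<mu> in at (\<kappa>\<^sup>2). csqrt \<mu> \<noteq> \<kappa>" by (auto simp: eventually_at_filter)
  qed
  from eventually_compose_filterlim[OF P this] show ?thesis by simp
qed

context comb
begin

lemma discriminant_notin_band:
  assumes "\<kappa>\<^sup>2 \<notin> specH a b (coup \<gamma> \<gamma>) \<theta>"
  shows "F \<gamma> \<notin> of_real ` {-1..1}"
  using band_in_spectrum assms unimodular_root_exists by (metis imageE)

lemma in_discrete_spectrum_iff:
  assumes "Re \<kappa> > 0" and gap: "F \<gamma> \<notin> of_real ` {-1..1}"
    and z: "z \<noteq> 0" "cmod z < 1" "z + 1/z = 2 * F \<gamma>"
  shows "\<kappa>\<^sup>2 \<in> disc_specH a b (coup \<gamma> \<gamma>t) \<theta> \<longleftrightarrow> F \<gamma>t = z"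
proof
  assume "\<kappa>\<^sup>2 \<in> disc_specH a b (coup \<gamma> \<gamma>t) \<theta>"
  then show "F \<gamma>t = z" using not_in_spectrum[OF z] by (auto simp: disc_specH_def)
next
  assume "F \<gamma>t = z"
  moreover have "\<forall>\<^sub>F \<mu> in at (\<kappa>\<^sup>2). \<mu> \<notin> specH a b (coup \<gamma> \<gamma>t) \<theta>"
    by (intro eventually_at_square assms(1)
        eventually_square_not_in_spectrum[OF a_pos b_pos sin_a sin_b gap])
  ultimately show "\<kappa>\<^sup>2 \<in> disc_specH a b (coup \<gamma> \<gamma>t) \<theta>"
    by (rule isolated_imp_in_discrete_spectrum[OF z])
qed

end

theorem theorem3p2:
  fixes a b \<gamma> \<gamma>t \<theta> E k \<tau> :: real
  assumes "a > 0" and "b > 0"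
    and "\<theta> \<in> {-pi..pi}"
    and "\<tau> = cos \<theta>"
    and "E > 0"
    and "complex_of_real E \<notin> specHg a b \<gamma> \<gamma> \<theta>"
    and "k = sqrt E"
    and "k \<notin> Xi a b"
  shows "complex_of_real E \<in> disc_specHg a b \<gamma> \<gamma>t \<theta> \<longleftrightarrow>
    (ff a b \<gamma>t \<tau> k =
      (if ff a b \<gamma> \<tau> k < -1 then ff a b \<gamma> \<tau> k + sqrt ((ff a b \<gamma> \<tau> k)^2 - 1)
       else ff a b \<gamma> \<tau> k - sqrt ((ff a b \<gamma> \<tau> k)^2 - 1)))"
proof -
  let ?f = "ff a b \<gamma> \<tau> k"
  have k: "k > 0" "complex_of_real E = (of_real k)\<^sup>2"
    using assms by (simp_all flip: of_real_power)
  have sin: "sin (k * a) \<noteq> 0" "sin (k * b) \<noteq> 0" using assms(8) k(1) by (auto simp: Xi_def)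
  interpret comb a b \<theta> "complex_of_real k"
    by unfold_locales (use assms(1,2) sin in \<open>auto simp: sin_of_real simp flip: of_real_mult\<close>)
  have F: "F g = of_real (ff a b g \<tau> k)" for g
    unfolding assms(4) by (rule discriminant_of_real[OF sin(2)])
  have gap: "F \<gamma> \<notin> of_real ` {-1..1}"
    using discriminant_notin_band assms(6) by (simp add: specHg_def k(2))
  then have "\<bar>?f\<bar> > 1" by (auto simp: F image_iff abs_le_iff not_less[symmetric])
  note root = contracting_root_nonzero[OF this] abs_contracting_root_less_1[OF this]
    contracting_root_eq[OF this]
  have "of_real (contracting_root ?f) + 1 / of_real (contracting_root ?f) = 2 * F \<gamma>"
    unfolding F using arg_cong[OF root(3), of complex_of_real] by simp
  then have "complex_of_real E \<in> disc_specHg a b \<gamma> \<gamma>t \<theta> \<longleftrightarrow> F \<gamma>t = of_real (contracting_root ?f)"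
    unfolding disc_specHg_def k(2) using root(1,2) k(1) gap
    by (intro in_discrete_spectrum_iff) simp_all
  then show ?thesis unfolding F of_real_eq_iff contracting_root_def .
qed

end
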